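(* Let $n\ge 1$, let $\alpha,\beta>0$ and $q_0,q_1\in[1,+\infty]$ with $q_0\ne q_1$. Let $\theta=\frac{\alpha}{\alpha+\beta}\in(0,1)$, let $p$ be defined by $\frac1p=\frac{1-\theta}{q_0}+\frac{\theta}{q_1}$, and let $r\in[1,+\infty]$. Then there is a constant $C_0$ (not depending on $f$) such that, if $f\in\dot B^{\alpha,q_0}_r\cap\dot B^{-\beta,q_1}_r(\mathbb{R}^n)$, then $f\in L^{p,r}(\mathbb{R}^n)$ and $$\|f\|_{L^{p,r}}\le C_0\,\|f\|_{\dot B^{\alpha,q_0}_r}^{1-\theta}\,\|f\|_{\dot B^{-\beta,q_1}_r}^{\theta}.$$
   Context: Littlewood–Paley decomposition: fix a nonnegative $\varphi\in C_c^\infty(\mathbb{R}^n)$ with $\varphi(\xi)=1$ for $|\xi|\le 1/2$ and $\varphi(\xi)=0$ for $|\xi|\ge 1$, and put $\psi(\xi)=\varphi(\xi/2)-\varphi(\xi)$. For $f\in\mathcal{S}'(\mathbb{R}^n)$ and $j\in\mathbb{Z}$, the dyadic block $\Delta_jf$ is defined by $\widehat{\Delta_jf}(\xi)=\psi(2^{-j}\xi)\widehat f(\xi)$. For $s\in\mathbb{R}$ and $q,r\in[1,+\infty]$, the semi-norm of the homogeneous Besov space $\dot B^{s,q}_r(\mathbb{R}^n)$ (first upper index: regularity; second upper index: Lebesgue exponent; lower index: summation exponent) is $\|f\|_{\dot B^{s,q}_r}=\big(\sum_{j\in\mathbb{Z}}2^{jsr}\|\Delta_jf\|_{L^q}^r\big)^{1/r}$,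 with the supremum over $j$ when $r=+\infty$. Convention: for $\alpha,\beta>0$, $f\in\dot B^{\alpha,q_0}_{r_0}\cap\dot B^{-\beta,q_1}_{r_1}$ means that $f\in\mathcal{S}'(\mathbb{R}^n)$ satisfies $f=\sum_{j\in\mathbb{Z}}\Delta_jf$ (convergence in $\mathcal{S}'$) and that both semi-norms are finite. Lorentz spaces: for $1<p<+\infty$, $1\le r\le+\infty$, $L^{p,r}(\mathbb{R}^n)$ is the set of measurable $f$ (modulo a.e. equality) with $\|f\|_{L^{p,r}}=\big(\int_0^{+\infty}(s^{1/p}f^*(s))^r\frac{ds}{s}\big)^{1/r}<+\infty$ (and $\sup_{s>0}s^{1/p}f^*(s)$ when $r=+\infty$), where $d_f(t)$ is the Lebesgue measure of $\{x:|f(x)|\ge t\}$ and $f^*(s)=\inf\{t:d_f(t)\le s\}$; equivalently, up to equivalence of norms, $L^{p,r}$ is the real interpolation space $[L^1,L^\infty]_{1-1/p,r}$. Note that $q_0\ne q_1$ forces $1<p<+\infty$. *)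

theory Defs
  imports "HOL-Analysis.Analysis" "HOL-Probability.Essential_Supremum"
begin

subsection \<open>Smooth functions, Schwartz functions, tempered distributions\<close>

fun partial_deriv ::
  "'a list \<Rightarrow> ('a::euclidean_space \<Rightarrow> 'b::real_normed_vector) \<Rightarrow> 'a \<Rightarrow> 'b" where
  "partial_deriv [] f = f"
| "partial_deriv (v # vs) f = (\<lambda>x. frechet_derivative (partial_deriv vs f) (at x) v)"

text \<open>Differentiability of all iterated partial derivatives entails their continuity, so the
  following is the class of infinitely differentiable functions.\<close>

definition smooth :: "('a::euclidean_space \<Rightarrow> 'b::real_normed_vector) \<Rightarrow> bool" where
  "smooth f \<longleftrightarrow> (\<forall>vs\<in>lists Basis. \<forall>x. partial_deriv vs f differentiable (at x))"

definition test_function :: "('a::euclidean_space \<Rightarrow> 'b::real_normed_vector) \<Rightarrow> bool" where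
  "test_function f \<longleftrightarrow> smooth f \<and> compact (closure {x. f x \<noteq> 0})"

definition schwartz :: "('a::euclidean_space \<Rightarrow> complex) set" where
  "schwartz = {u. smooth u \<and>
     (\<forall>k::nat. \<forall>vs\<in>lists Basis.
        bdd_above (range (\<lambda>x. (1 + norm x) ^ k * norm (partial_deriv vs u x))))}"

definition schwartz_seminorm :: "nat \<Rightarrow> ('a::euclidean_space \<Rightarrow> complex) \<Rightarrow> real" where
  "schwartz_seminorm N u =
     (\<Sum>vs\<in>{vs\<in>lists Basis. length vs \<le> N}.
        SUP x. (1 + norm x) ^ N * norm (partial_deriv vs u x))"

text \<open>A distribution is a functional on functions of which only the values on Schwartz functions
  matter. Continuity for the Schwartz topology is domination by one of its (increasing)
  defining seminorms.\<close>

type_synonym 'a functional = "('a \<Rightarrow> complex) \<Rightarrow> complex"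

definition tempered_distribution :: "'a::euclidean_space functional \<Rightarrow> bool" where
  "tempered_distribution T \<longleftrightarrow>
     (\<forall>u\<in>schwartz. \<forall>v\<in>schwartz. T (\<lambda>x. u x + v x) = T u + T v) \<and>
     (\<forall>c. \<forall>u\<in>schwartz. T (\<lambda>x. c * u x) = c * T u) \<and>
     (\<exists>C N. \<forall>u\<in>schwartz. norm (T u) \<le> C * schwartz_seminorm N u)"

text \<open>The distribution \<open>T\<close> is (integration against) the function \<open>g\<close>. Such a \<open>g\<close> is unique
  up to almost everywhere equality.\<close>

definition represents :: "('a::euclidean_space \<Rightarrow> complex) \<Rightarrow> 'a functional \<Rightarrow> bool" where
  "represents g T \<longleftrightarrow> g \<in> borel_measurable lborel \<and>
     (\<forall>u\<in>schwartz. integrable lborel (\<lambda>x. g x * u x) \<and> T u = (\<integral>x. g x * u x \<partial>lborel))"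


subsection \<open>Fourier transform and dyadic blocks\<close>

definition fourier :: "('a::euclidean_space \<Rightarrow> complex) \<Rightarrow> 'a \<Rightarrow> complex" where
  "fourier u \<xi> = (\<integral>x. cis (- (x \<bullet> \<xi>)) * u x \<partial>lborel)"

definition inv_fourier :: "('a::euclidean_space \<Rightarrow> complex) \<Rightarrow> 'a \<Rightarrow> complex" where
  "inv_fourier u x = (\<integral>\<xi>. cis (x \<bullet> \<xi>) * u \<xi> \<partial>lborel) / of_real ((2 * pi) ^ DIM('a))"

definition fourier_dist :: "'a::euclidean_space functional \<Rightarrow> 'a functional" where
  "fourier_dist T = (\<lambda>u. T (fourier u))"

definition inv_fourier_dist :: "'a::euclidean_space functional \<Rightarrow> 'a functional" where
  "inv_fourier_dist T = (\<lambda>u. T (inv_fourier u))"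

definition mult_dist ::
  "('a::euclidean_space \<Rightarrow> real) \<Rightarrow> 'a functional \<Rightarrow> 'a functional" where
  "mult_dist m T = (\<lambda>u. T (\<lambda>\<xi>. of_real (m \<xi>) * u \<xi>))"

definition LP_cutoff :: "('a::euclidean_space \<Rightarrow> real) \<Rightarrow> bool" where
  "LP_cutoff \<phi> \<longleftrightarrow> test_function \<phi> \<and> (\<forall>\<xi>. 0 \<le> \<phi> \<xi>) \<and>
     (\<forall>\<xi>. norm \<xi> \<le> 1/2 \<longrightarrow> \<phi> \<xi> = 1) \<and> (\<forall>\<xi>. 1 \<le> norm \<xi> \<longrightarrow> \<phi> \<xi> = 0)"

definition LP_annulus :: "('a::euclidean_space \<Rightarrow> real) \<Rightarrow> 'a \<Rightarrow> real" where
  "LP_annulus \<phi> \<xi> = \<phi> (\<xi> /\<^sub>R 2) - \<phi> \<xi>"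

definition dyadic_block ::
  "('a::euclidean_space \<Rightarrow> real) \<Rightarrow> int \<Rightarrow> 'a functional \<Rightarrow> 'a functional" where
  "dyadic_block \<phi> j T =
     inv_fourier_dist
       (mult_dist (\<lambda>\<xi>. LP_annulus \<phi> ((2 powr (- real_of_int j)) *\<^sub>R \<xi>)) (fourier_dist T))"


subsection \<open>Lebesgue, Besov and Lorentz norms\<close>

text \<open>Real powers on the extended nonnegative reals; only used for exponents \<open>a > 0\<close>.\<close>

definition epowr :: "ennreal \<Rightarrow> real \<Rightarrow> ennreal" where
  "epowr x a = (if x = \<infinity> then \<infinity> else ennreal (enn2real x powr a))"

definition Lq_norm :: "ennreal \<Rightarrow> ('a::euclidean_space \<Rightarrow> complex) \<Rightarrow> ennreal" where
  "Lq_norm q g =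
     (if q = \<infinity> then esssup lborel (\<lambda>x. ennreal (norm (g x)))
      else epowr (\<integral>\<^sup>+x. epowr (ennreal (norm (g x))) (enn2real q) \<partial>lborel) (1 / enn2real q))"

text \<open>The norm of a distribution is that of the function representing it. The infimum ranges over
  a single almost everywhere class; it is \<open>\<infinity>\<close> if the distribution is not a function.\<close>

definition Lq_norm_dist :: "ennreal \<Rightarrow> 'a::euclidean_space functional \<Rightarrow> ennreal" where
  "Lq_norm_dist q T = (INF g\<in>{g. represents g T}. Lq_norm q g)"

definition besov_seminorm ::
  "('a::euclidean_space \<Rightarrow> real) \<Rightarrow> real \<Rightarrow> ennreal \<Rightarrow> ennreal \<Rightarrow> 'a functional \<Rightarrow> ennreal" where
  "besov_seminorm \<phi> s q r T =
     (if r = \<infinity> then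
        (SUP j::int. ennreal (2 powr (real_of_int j * s)) * Lq_norm_dist q (dyadic_block \<phi> j T))
      else
        epowr (\<Sum>\<^sub>\<infinity>j::int. ennreal (2 powr (real_of_int j * s * enn2real r)) *
                 epowr (Lq_norm_dist q (dyadic_block \<phi> j T)) (enn2real r))
          (1 / enn2real r))"

definition LP_sum_converges :: "('a::euclidean_space \<Rightarrow> real) \<Rightarrow> 'a functional \<Rightarrow> bool" where
  "LP_sum_converges \<phi> T \<longleftrightarrow>
     (\<forall>u\<in>schwartz.
        ((\<lambda>(M, N). \<Sum>j\<in>{- int M..int N}. dyadic_block \<phi> j T u) \<longlongrightarrow> T u)
          (sequentially \<times>\<^sub>F sequentially))"

definition in_besov_inter ::
  "('a::euclidean_space \<Rightarrow> real) \<Rightarrow> real \<Rightarrow> ennreal \<Rightarrow> ennreal \<Rightarrow> real \<Rightarrow> ennreal \<Rightarrow> ennreal \<Rightarrow>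
     'a functional \<Rightarrow> bool" where
  "in_besov_inter \<phi> s\<^sub>0 q\<^sub>0 r\<^sub>0 s\<^sub>1 q\<^sub>1 r\<^sub>1 T \<longleftrightarrow>
     tempered_distribution T \<and> LP_sum_converges \<phi> T \<and>
     besov_seminorm \<phi> s\<^sub>0 q\<^sub>0 r\<^sub>0 T < \<infinity> \<and> besov_seminorm \<phi> s\<^sub>1 q\<^sub>1 r\<^sub>1 T < \<infinity>"

definition distribution_fun :: "('a::euclidean_space \<Rightarrow> complex) \<Rightarrow> real \<Rightarrow> ennreal" where
  "distribution_fun g t = emeasure lborel {x. t \<le> norm (g x)}"

definition rearrangement :: "('a::euclidean_space \<Rightarrow> complex) \<Rightarrow> real \<Rightarrow> ennreal" where
  "rearrangement g s = Inf {ennreal t | t. 0 \<le> t \<and> distribution_fun g t \<le> ennreal s}"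

definition lorentz_norm :: "real \<Rightarrow> ennreal \<Rightarrow> ('a::euclidean_space \<Rightarrow> complex) \<Rightarrow> ennreal" where
  "lorentz_norm p r g =
     (if r = \<infinity> then (SUP s\<in>{0<..}. ennreal (s powr (1 / p)) * rearrangement g s)
      else
        epowr (\<integral>\<^sup>+s\<in>{0<..}. (epowr (ennreal (s powr (1 / p)) * rearrangement g s) (enn2real r)
                              / ennreal s) \<partial>lborel)
          (1 / enn2real r))"

end

theory Submission
  imports Defs
begin

text \<open>Write \<open>f\<^sub>j\<close> for the function representing the \<open>j\<close>-th dyadic block; it is unique almost
  everywhere, so its \<open>L^q0\<close> and \<open>L^q1\<close> norms are those of one function, and no further
  property of the blocks is needed. On a set \<open>E\<close> of measure \<open>m\<close> one has
  \<open>\<integral>\<^sub>E |f\<^sub>j| \<le> 2 m^(1 - 1/q) \<parallel>f\<^sub>j\<parallel>\<^sub>q\<close> for both exponents. Summing over \<open>j\<close> and taking \<open>E\<close> inside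
  \<open>{|g| \<ge> t}\<close> with \<open>g = \<Sum> f\<^sub>j\<close> gives
  \<open>g*(s) \<le> 2 \<Sum>\<^sub>j min (s^(-1/q0) \<parallel>f\<^sub>j\<parallel>\<^sub>q\<^sub>0) (s^(-1/q1) \<parallel>f\<^sub>j\<parallel>\<^sub>q\<^sub>1)\<close>. After multiplication by \<open>s^(1/p)\<close>
  the \<open>j\<close>-th term is at most \<open>k (c s^\<gamma> 2^(-j)) d\<^sub>j\<close> with \<open>k x = min (x^\<alpha>) (x^(-\<beta>))\<close> and
  \<open>\<gamma> = (1/q1 - 1/q0) / (\<alpha> + \<beta>) \<noteq> 0\<close>, where \<open>d\<^sub>j\<close> is the larger of the two weighted norms and
  \<open>c\<close> is chosen to balance the two semi-norms. The kernel is summable in \<open>j\<close> uniformly in \<open>s\<close>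
  and integrable in \<open>ds/s\<close> uniformly in \<open>j\<close>, and Schur's test concludes.\<close>

section \<open>Power-type bounds replacing Hoelder and Minkowski\<close>

lemma epowr_ennreal: "0 \<le> x \<Longrightarrow> epowr (ennreal x) a = ennreal (x powr a)"
  by (simp add: epowr_def)

lemma epowr_top [simp]: "epowr top a = top"
  by (simp add: epowr_def)

lemma epowr_epowr:
  assumes "0 < a" shows "epowr (epowr x a) (1 / a) = x" "epowr (epowr x (1 / a)) a = x"
  using assms by (cases x; simp add: epowr_def powr_powr)+

lemma epowr_mono: "0 < a \<Longrightarrow> x \<le> y \<Longrightarrow> epowr x a \<le> epowr y a"
  by (cases x; cases y) (auto simp: epowr_def simp: top_unique intro!: powr_mono2 ennreal_leI)

lemma epowr_mult:
  assumes "0 < a" shows "epowr (x * y) a = epowr x a * epowr y a"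
proof (cases x)
  case (real x')
  then show ?thesis
    using assms by (cases y; cases "x' = 0")
      (auto simp: epowr_def powr_mult ennreal_mult_top ennreal_mult'[symmetric] ennreal_eq_0_iff)
next
  case top
  then show ?thesis
    using assms by (cases y) (auto simp: epowr_def ennreal_top_mult ennreal_eq_0_iff)
qed

lemma measurable_epowr [measurable]: "(\<lambda>x. epowr x a) \<in> borel_measurable borel"
  unfolding epowr_def by measurable

text \<open>Splitting by whether \<open>x \<le> l\<close> and then choosing \<open>l\<close> replaces the Hoelder
  inequality, up to a factor \<open>2\<close>.\<close>

lemma le_add_powr:
  fixes x l q :: real
  assumes "0 \<le> x" "0 < l" "1 \<le> q"
  shows "x \<le> l + l powr (1 - q) * x powr q"
proof (cases "x \<le> l")
  case False
  then have "x powr (1 - q) \<le> l powr (1 - q)"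
    using assms by (intro powr_mono2') auto
  then have "x powr (1 - q) * x powr q \<le> l powr (1 - q) * x powr q"
    by (intro mult_right_mono) auto
  moreover have "x powr (1 - q) * x powr q = x"
    using False assms by (simp flip: powr_add)
  ultimately show ?thesis using assms by simp
next
  case True
  have "0 \<le> l powr (1 - q) * x powr q"
    by simp
  then show ?thesis using True by linarith
qed

lemma le_add_epowr:
  assumes "0 < l" "1 \<le> q"
  shows "x \<le> ennreal l + ennreal (l powr (1 - q)) * epowr x q"
proof (cases x)
  case (real x')
  then show ?thesis
    using assms le_add_powr[of x' l q]
    by (simp add: epowr_ennreal ennreal_mult'[symmetric] ennreal_plus[symmetric] del: ennreal_plus)
next
  case top
  then show ?thesis using assms by (simp add: ennreal_mult_top ennreal_eq_0_iff)
qed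

text \<open>The measure is kept arbitrary because the bound serves twice: with Lebesgue measure for
  functions, and with counting measure for weighted series. The level \<open>l\<close> stays free so
  that each application can balance the two terms.\<close>

lemma nn_integral_mult_le_epowr:
  assumes "0 < l" "1 \<le> q" and [measurable]: "f \<in> borel_measurable M" "w \<in> borel_measurable M"
  shows "(\<integral>\<^sup>+x. f x * w x \<partial>M)
    \<le> ennreal l * (\<integral>\<^sup>+x. w x \<partial>M) + ennreal (l powr (1 - q)) * (\<integral>\<^sup>+x. epowr (f x) q * w x \<partial>M)"
proof -
  have "(\<integral>\<^sup>+x. f x * w x \<partial>M)
      \<le> (\<integral>\<^sup>+x. ennreal l * w x + ennreal (l powr (1 - q)) * (epowr (f x) q * w x) \<partial>M)"
  proof (rule nn_integral_mono)
    fix x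
    have "f x * w x \<le> (ennreal l + ennreal (l powr (1 - q)) * epowr (f x) q) * w x"
      by (intro mult_right_mono le_add_epowr assms) auto
    then show "f x * w x \<le> ennreal l * w x + ennreal (l powr (1 - q)) * (epowr (f x) q * w x)"
      by (simp add: distrib_right mult.assoc)
  qed
  also have "\<dots> = ennreal l * (\<integral>\<^sup>+x. w x \<partial>M) +
      ennreal (l powr (1 - q)) * (\<integral>\<^sup>+x. epowr (f x) q * w x \<partial>M)"
    by (simp add: nn_integral_add nn_integral_cmult)
  finally show ?thesis .
qed

lemma inverse_exponent:
  assumes "1 \<le> q" "q \<noteq> (\<infinity>::ennreal)"
  shows "1 \<le> enn2real q" "enn2real (1 / q) = 1 / enn2real q" "ennreal (enn2real q) = q"
proof -
  obtain x where x: "q = ennreal x" "0 \<le> x"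
    using assms(2) by (cases q) auto
  then have "1 \<le> x"
    using assms(1) by (metis ennreal_1 ennreal_le_iff)
  then show "1 \<le> enn2real q" "enn2real (1 / q) = 1 / enn2real q" "ennreal (enn2real q) = q"
    using x by (auto simp: divide_ennreal[symmetric] simp flip: ennreal_1)
qed

text \<open>Splitting at the level \<open>N * x\<close> makes both terms proportional to N, since
  N^(1-Q) N^Q = N. For q infinite no splitting takes place: the essential supremum gives N times the
  integral of w, which matches the right-hand side with x = 1.\<close>

lemma nn_integral_mult_le_Lq_norm_aux:
  fixes g :: "'a::euclidean_space \<Rightarrow> complex"
  assumes "1 \<le> q" and [measurable]: "g \<in> borel_measurable lborel" "w \<in> borel_measurable lborel"
    and "0 < x" "0 < N" "Lq_norm q g \<le> ennreal N" "\<And>y. w y \<le> ennreal W"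
    and "q = \<infinity> \<Longrightarrow> x = 1"
  shows "(\<integral>\<^sup>+y. ennreal (norm (g y)) * w y \<partial>lborel) \<le> ennreal N * (ennreal x * (\<integral>\<^sup>+y. w y \<partial>lborel) +
    (if q = \<infinity> then 0 else ennreal (x powr (1 - enn2real q) * W)))"
    (is "?I \<le> _")
proof (cases "q = \<infinity>")
  case True
  then have le: "esssup lborel (\<lambda>y. ennreal (norm (g y))) \<le> ennreal N"
    using assms by (simp add: Lq_norm_def)
  from esssup_AE[where M = lborel and f = "\<lambda>y. ennreal (norm (g y))"]
  have "AE y in lborel. ennreal (norm (g y)) \<le> ennreal N"
    by eventually_elim (rule order.trans[OF _ le])
  then have "?I \<le> (\<integral>\<^sup>+y. ennreal N * w y \<partial>lborel)"
    by (intro nn_integral_mono_AE) (auto elim!: eventually_mono intro: mult_right_mono)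
  then show ?thesis
    using True assms by (simp add: nn_integral_cmult)
next
  case False
  define Q where "Q = enn2real q"
  have Q: "1 \<le> Q"
    using inverse_exponent False assms(1) unfolding Q_def by blast
  have "epowr (Lq_norm q g) Q \<le> epowr (ennreal N) Q"
    using assms Q by (intro epowr_mono) auto
  then have *: "(\<integral>\<^sup>+x. epowr (ennreal (norm (g x))) Q \<partial>lborel) \<le> ennreal (N powr Q)"
    using False Q \<open>0 < N\<close> by (simp add: Lq_norm_def epowr_epowr epowr_ennreal flip: Q_def)
  have "?I \<le> ennreal (N * x) * (\<integral>\<^sup>+y. w y \<partial>lborel) +
      ennreal ((N * x) powr (1 - Q)) * (\<integral>\<^sup>+y. epowr (ennreal (norm (g y))) Q * w y \<partial>lborel)"
    using assms Q by (intro nn_integral_mult_le_epowr) auto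
  also have "(\<integral>\<^sup>+y. epowr (ennreal (norm (g y))) Q * w y \<partial>lborel)
      \<le> (\<integral>\<^sup>+y. epowr (ennreal (norm (g y))) Q * ennreal W \<partial>lborel)"
    using assms by (intro nn_integral_mono mult_left_mono) auto
  also have "\<dots> = (\<integral>\<^sup>+y. epowr (ennreal (norm (g y))) Q \<partial>lborel) * ennreal W"
    by (rule nn_integral_multc) measurable
  also have "\<dots> \<le> ennreal (N powr Q) * ennreal W"
    using * by (intro mult_right_mono) auto
  also have "ennreal ((N * x) powr (1 - Q)) * (ennreal (N powr Q) * ennreal W)
     = ennreal N * ennreal (x powr (1 - Q) * W)"
  proof -
    have "N powr (1 - Q) * N powr Q = N"
      using assms by (simp flip: powr_add)
    then show ?thesis
      using assms by (simp add: powr_mult flip: ennreal_mult') (metis mult.assoc mult.commute)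
  qed
  finally show ?thesis
    using False assms by (simp add: distrib_left ennreal_mult' mult.assoc add_left_mono mult_left_mono flip: Q_def)
qed

text \<open>Splitting levels are built from a norm and must be positive and finite. Working with a
  positive real majorant N instead of the norm avoids the cases 0 and infinity; letting N decrease
  to y recovers the bound, and y infinite is trivial because C > 0.\<close>

lemma ennreal_le_scaled_limit:
  assumes "\<And>N. 0 < N \<Longrightarrow> y \<le> ennreal N \<Longrightarrow> z \<le> C * ennreal N" "C < \<infinity>" "0 < C"
  shows "z \<le> C * y"
proof (cases y)
  case (real y')
  obtain c where c: "C = ennreal c" "0 < c"
    using assms(2,3) by (cases C) (auto simp: ennreal_less_zero_iff)
  show ?thesis
  proof (rule ennreal_le_epsilon)
    fix e :: real assume e: "0 < e"
    have "z \<le> C * ennreal (y' + e / c)"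
      using e c real by (intro assms(1)) (auto intro: ennreal_leI add_nonneg_pos)
    also have "\<dots> = C * y + ennreal e"
      using e c real by (simp add: distrib_left ennreal_mult'[symmetric] del: ennreal_plus flip: ennreal_plus)
    finally show "z \<le> C * y + ennreal e" .
  qed
next
  case top
  then show ?thesis using assms(3) by (auto simp: ennreal_mult_top)
qed

lemma nn_integral_set_le_Lq_norm:
  fixes g :: "'a::euclidean_space \<Rightarrow> complex"
  assumes "1 \<le> q" and [measurable]: "g \<in> borel_measurable lborel" "E \<in> sets lborel"
    and "emeasure lborel E = ennreal m" "0 < m"
  shows "(\<integral>\<^sup>+y\<in>E. ennreal (norm (g y)) \<partial>lborel) \<le> ennreal (2 * m powr (1 - enn2real (1 / q))) * Lq_norm q g"
proof (rule ennreal_le_scaled_limit)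
  fix N :: real assume N: "0 < N" "Lq_norm q g \<le> ennreal N"
  \<comment> \<open>This choice balances the two terms: x m and x^(1-q) both equal m^(1-1/q), whence
    the factor 2. For q infinite the exponent is 0 and x = 1.\<close>
  define x where "x = m powr (- enn2real (1 / q))"
  have "(\<integral>\<^sup>+y\<in>E. ennreal (norm (g y)) \<partial>lborel) \<le> ennreal N * (ennreal x * (\<integral>\<^sup>+y. indicator E y \<partial>lborel) +
    (if q = \<infinity> then 0 else ennreal (x powr (1 - enn2real q) * 1)))"
    using N assms by (intro nn_integral_mult_le_Lq_norm_aux) (auto simp: x_def indicator_def)
  also have "\<dots> \<le> ennreal N * ennreal (2 * m powr (1 - enn2real (1 / q)))"
  proof (rule mult_left_mono)
    have 1: "x * m = m powr (1 - enn2real (1 / q))"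
      using assms by (simp add: x_def powr_diff powr_minus divide_simps)
    have 2: "x powr (1 - enn2real q) = m powr (1 - enn2real (1 / q))" if "q \<noteq> \<infinity>"
      using inverse_exponent[OF assms(1) that] by (simp add: x_def powr_powr field_simps)
    show "ennreal x * (\<integral>\<^sup>+y. indicator E y \<partial>lborel) +
        (if q = \<infinity> then 0 else ennreal (x powr (1 - enn2real q) * 1))
      \<le> ennreal (2 * m powr (1 - enn2real (1 / q)))"
      using assms 1 2 by (auto simp: ennreal_mult'[symmetric] x_def simp flip: ennreal_plus intro: ennreal_leI)
  qed auto
  finally show "(\<integral>\<^sup>+y\<in>E. ennreal (norm (g y)) \<partial>lborel) \<le> ennreal (2 * m powr (1 - enn2real (1 / q))) * ennreal N"
    by (simp add: mult.commute)
qed (use assms in \<open>auto simp: ennreal_less_zero_iff\<close>)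

section \<open>Schwartz functions: decay, integrability and pairing with L^q functions\<close>

lemma smooth_imp_continuous: 
  assumes "smooth u" "vs \<in> lists Basis"
  shows "continuous_on A (partial_deriv vs u)"
  using assms unfolding smooth_def
  by (meson continuous_at_imp_continuous_on differentiable_imp_continuous_within)

lemma schwartz_measurable: "u \<in> schwartz \<Longrightarrow> u \<in> borel_measurable borel"
  using smooth_imp_continuous[of u "[]" UNIV]
  by (auto simp: schwartz_def intro: borel_measurable_continuous_onI)

lemma schwartz_decay:
  assumes "u \<in> schwartz"
  obtains W where "0 < W" "\<And>x. (1 + norm x) ^ k * norm (u x) \<le> W"
proof -
  have "\<forall>vs\<in>lists Basis. bdd_above (range (\<lambda>x. (1 + norm x) ^ k * norm (partial_deriv vs u x)))"
    using assms by (simp add: schwartz_def)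
  then have "bdd_above (range (\<lambda>x. (1 + norm x) ^ k * norm (partial_deriv [] u x)))"
    by (rule bspec) simp
  then obtain W where "(1 + norm x) ^ k * norm (u x) \<le> W" for x
    by (auto simp: bdd_above_def)
  then have "(1 + norm x) ^ k * norm (u x) \<le> max W 1" for x
    by (metis max.coboundedI1)
  then show ?thesis using that[of "max W 1"] by auto
qed

lemma emeasure_ball_le: "0 \<le> R \<Longrightarrow> emeasure lborel (ball (0::'a::euclidean_space) R) \<le> ennreal ((2 * R) ^ DIM('a))"
proof -
  assume R: "0 \<le> R"
  have "ball (0::'a) R \<subseteq> cbox (- (R *\<^sub>R One)) (R *\<^sub>R One)"
  proof
    fix x :: 'a assume "x \<in> ball 0 R"
    then have "\<bar>x \<bullet> i\<bar> \<le> R" if "i \<in> Basis" for i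
      using Basis_le_norm[OF that, of x] by simp
    then show "x \<in> cbox (- (R *\<^sub>R One)) (R *\<^sub>R One)"
      by (force simp: mem_box abs_le_iff)
  qed
  then have "emeasure lborel (ball (0::'a) R) \<le> emeasure lborel (cbox (- (R *\<^sub>R One)) (R *\<^sub>R One :: 'a))"
    by (intro emeasure_mono) auto
  also have "\<dots> = ennreal ((2 * R) ^ DIM('a))"
  proof -
    have "(\<Prod>i\<in>Basis. (R *\<^sub>R One - (- (R *\<^sub>R One)) :: 'a) \<bullet> i) = (\<Prod>i\<in>(Basis::'a set). 2 * R)"
      by (rule prod.cong) (auto simp: inner_add_left)
    then show ?thesis
      using R by (subst emeasure_lborel_cbox) auto
  qed
  finally show ?thesis .
qed

text \<open>On the shell n \<le> |x| < n+1 in dimension d, decay of order d+2 bounds |u| by W /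
  (1+n)^(d+2), and the ball containing the shell has measure at most (2(1+n))^d. The products are a
  constant times 1/(1+n)^2, which is summable.\<close>

lemma nn_integral_schwartz_finite:
  fixes u :: "'a::euclidean_space \<Rightarrow> complex"
  assumes u: "u \<in> schwartz"
  shows "(\<integral>\<^sup>+x. ennreal (norm (u x)) \<partial>lborel) < \<infinity>"
proof -
  obtain W where W: "0 < W" "\<And>x. (1 + norm x) ^ (DIM('a) + 2) * norm (u x) \<le> W"
    using schwartz_decay[OF u] by metis
  define F where "F n = W * 2 ^ DIM('a) * (1 / (1 + real n) ^ 2)" for n
  define G where "G x = (\<lambda>n. ennreal (W / (1 + real n) ^ (DIM('a) + 2)) * indicator (ball 0 (1 + real n)) x)"
    for x :: 'a
  have *: "ennreal (norm (u x)) \<le> (\<Sum>n. ennreal (W / (1 + real n) ^ (DIM('a) + 2)) * indicator (ball 0 (1 + real n)) x)" for x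
  proof -
    define n where "n = nat \<lfloor>norm x\<rfloor>"
    have n: "real n \<le> norm x" "norm x < 1 + real n"
      unfolding n_def by (simp, linarith)
    have "(1 + real n) ^ (DIM('a) + 2) * norm (u x) \<le> (1 + norm x) ^ (DIM('a) + 2) * norm (u x)"
      using n by (intro mult_right_mono power_mono) auto
    then have "norm (u x) \<le> W / (1 + real n) ^ (DIM('a) + 2)"
      using W(2)[of x] by (simp add: pos_le_divide_eq mult.commute del: power_Suc power_add)
    then have "ennreal (norm (u x)) \<le> ennreal (W / (1 + real n) ^ (DIM('a) + 2)) * indicator (ball 0 (1 + real n)) x"
      using n by (simp add: ennreal_leI)
    also have "\<dots> = G x n"
      by (simp only: G_def)
    also have "\<dots> \<le> suminf (G x)"
      using sum_le_suminf[of "G x" "{n}"] by simp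
    finally show ?thesis
      by (simp only: G_def)
  qed
  have "(\<integral>\<^sup>+x. ennreal (norm (u x)) \<partial>lborel)
    \<le> (\<integral>\<^sup>+x. (\<Sum>n. ennreal (W / (1 + real n) ^ (DIM('a) + 2)) * indicator (ball (0::'a) (1 + real n)) x) \<partial>lborel)"
    by (rule nn_integral_mono) (rule *)
  also have "\<dots> = (\<Sum>n. ennreal (W / (1 + real n) ^ (DIM('a) + 2)) * emeasure lborel (ball (0::'a) (1 + real n)))"
    by (subst nn_integral_suminf)
       (auto intro!: borel_measurable_times_ennreal borel_measurable_indicator suminf_cong
          nn_integral_cmult_indicator simp del: power_add_numeral)
  also have "\<dots> \<le> (\<Sum>n. ennreal (F n))"
  proof (rule suminf_le)
    fix n
    have "ennreal (W / (1 + real n) ^ (DIM('a) + 2)) * emeasure lborel (ball (0::'a) (1 + real n))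
      \<le> ennreal (W / (1 + real n) ^ (DIM('a) + 2)) * ennreal ((2 * (1 + real n)) ^ DIM('a))"
      by (intro mult_left_mono emeasure_ball_le) auto
    also have "\<dots> = ennreal (F n)"
    proof -
      have "W / t ^ (d + 2) * (2 * t) ^ d = W * 2 ^ d * (1 / t ^ 2)" if "0 < t" for t :: real and d :: nat
        using that by (simp add: power_mult_distrib power_add power2_eq_square)
      from this[of "1 + real n" "DIM('a)"] show ?thesis
        using W(1) unfolding F_def by (subst ennreal_mult'[symmetric]) simp_all
    qed
    finally show "ennreal (W / (1 + real n) ^ (DIM('a) + 2)) * emeasure lborel (ball (0::'a) (1 + real n)) \<le> ennreal (F n)" .
  qed auto
  also have "\<dots> < \<infinity>"
  proof -
    have "summable (\<lambda>n. 1 / (1 + real n) ^ 2)"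
      using inverse_power_summable[of 2, where 'a=real] summable_Suc_iff[of "\<lambda>n. inverse (real n ^ 2)"]
      by (simp add: inverse_eq_divide add.commute)
    then have "summable F"
      unfolding F_def by (rule summable_mult)
    then show ?thesis
      using W(1) by (subst suminf_ennreal2) (auto simp: F_def)
  qed
  finally show ?thesis .
qed

text \<open>The level x = 1 gives the constant V + W, the L^1 norm of u plus a bound for its
  supremum. As it depends on u alone, a block can later be paired with u at the cost of the smaller
  of its two norms.\<close>

lemma nn_integral_schwartz_le_Lq_norm:
  fixes u :: "'a::euclidean_space \<Rightarrow> complex"
  assumes u: "u \<in> schwartz"
  obtains C where "0 < C" "\<And>q g. 1 \<le> q \<Longrightarrow> g \<in> borel_measurable lborel \<Longrightarrow>
    (\<integral>\<^sup>+y. ennreal (norm (g y)) * ennreal (norm (u y)) \<partial>lborel) \<le> ennreal C * Lq_norm q g"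
proof -
  obtain W where W: "0 < W" "\<And>x. norm (u x) \<le> W"
    using schwartz_decay[OF u, of 0] by auto
  obtain V where V: "0 \<le> V" "(\<integral>\<^sup>+x. ennreal (norm (u x)) \<partial>lborel) = ennreal V"
    using nn_integral_schwartz_finite[OF u] by (cases "\<integral>\<^sup>+x. ennreal (norm (u x)) \<partial>lborel") auto
  note [measurable] = schwartz_measurable[OF u]
  have "(\<integral>\<^sup>+y. ennreal (norm (g y)) * ennreal (norm (u y)) \<partial>lborel) \<le> ennreal (V + W) * Lq_norm q g"
    if "1 \<le> q" and [measurable]: "g \<in> borel_measurable lborel" for q and g :: "'a \<Rightarrow> complex"
  proof (rule ennreal_le_scaled_limit)
    fix N :: real assume N: "0 < N" "Lq_norm q g \<le> ennreal N"
    have "(\<integral>\<^sup>+y. ennreal (norm (g y)) * ennreal (norm (u y)) \<partial>lborel) \<le> 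
        ennreal N * (ennreal 1 * (\<integral>\<^sup>+y. ennreal (norm (u y)) \<partial>lborel) +
          (if q = \<infinity> then 0 else ennreal (1 powr (1 - enn2real q) * W)))"
      using N W that by (intro nn_integral_mult_le_Lq_norm_aux) (auto intro: ennreal_leI)
    also have "\<dots> \<le> ennreal N * ennreal (V + W)"
      using V W by (intro mult_left_mono) auto
    finally show "(\<integral>\<^sup>+y. ennreal (norm (g y)) * ennreal (norm (u y)) \<partial>lborel) \<le> ennreal (V + W) * ennreal N"
      by (simp add: mult.commute)
  qed (use V W in \<open>auto simp: ennreal_less_zero_iff simp flip: ennreal_plus\<close>)
  then show ?thesis using that[of "V + W"] V W by auto
qed

section \<open>Uniqueness of the representing function\<close>

lemma has_derivative_partial_deriv:
  assumes "smooth f" "vs \<in> lists Basis"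
  shows "(partial_deriv vs f has_derivative frechet_derivative (partial_deriv vs f) (at x)) (at x)"
  using assms unfolding smooth_def by (simp add: frechet_derivative_works)

text \<open>Stated for the closed form of an iterated derivative, because this is the expression
  that the induction in \<open>partial_deriv_affine\<close> has to differentiate once more.\<close>

lemma has_derivative_partial_deriv_affine:
  fixes \<phi> :: "'a::euclidean_space \<Rightarrow> real"
  assumes "smooth \<phi>" "vs \<in> lists Basis"
  shows "((\<lambda>x. complex_of_real (c ^ length vs * partial_deriv vs \<phi> (c *\<^sub>R (x - a)))) has_derivative
    (\<lambda>h. complex_of_real (c ^ length vs * frechet_derivative (partial_deriv vs \<phi>) (at (c *\<^sub>R (x - a))) (c *\<^sub>R h)))) (at x)"
proof -
  have "((\<lambda>x. partial_deriv vs \<phi> (c *\<^sub>R (x - a))) has_derivative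
      (\<lambda>h. frechet_derivative (partial_deriv vs \<phi>) (at (c *\<^sub>R (x - a))) (c *\<^sub>R h))) (at x)"
    by (rule has_derivative_compose[of "\<lambda>x. c *\<^sub>R (x - a)" "\<lambda>h. c *\<^sub>R h"])
       (auto intro!: derivative_eq_intros has_derivative_partial_deriv assms)
  then show ?thesis
    by (intro has_derivative_of_real has_derivative_mult_right)
qed

lemma partial_deriv_affine:
  fixes \<phi> :: "'a::euclidean_space \<Rightarrow> real"
  assumes "smooth \<phi>" "vs \<in> lists Basis"
  shows "partial_deriv vs (\<lambda>x. complex_of_real (\<phi> (c *\<^sub>R (x - a)))) = (\<lambda>x. complex_of_real (c ^ length vs * partial_deriv vs \<phi> (c *\<^sub>R (x - a))))"
  using assms(2)
proof (induction vs)
  case (Cons v vs)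
  then have vs: "vs \<in> lists Basis" by simp
  have "frechet_derivative (partial_deriv vs \<phi>) (at y) (c *\<^sub>R v)
    = c * frechet_derivative (partial_deriv vs \<phi>) (at y) v" for y
    using has_derivative_linear[OF has_derivative_partial_deriv[OF assms(1) vs]] by (simp add: linear_scale)
  then show ?case
    using Cons vs
    by (simp add: frechet_derivative_at[OF has_derivative_partial_deriv_affine[OF assms(1) vs], symmetric]
      mult.assoc mult.left_commute del: of_real_mult of_real_power)
qed simp

lemma smooth_affine:
  fixes \<phi> :: "'a::euclidean_space \<Rightarrow> real"
  assumes "smooth \<phi>"
  shows "smooth (\<lambda>x. complex_of_real (\<phi> (c *\<^sub>R (x - a))))"
  unfolding smooth_def
  using partial_deriv_affine[OF assms] has_derivative_partial_deriv_affine[OF assms]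
  by (metis differentiableI)

lemma LP_cutoff_smooth: "LP_cutoff \<phi> \<Longrightarrow> smooth \<phi>"
  by (simp add: LP_cutoff_def test_function_def)

lemma LP_cutoff_continuous: "LP_cutoff \<phi> \<Longrightarrow> continuous_on A \<phi>"
  using smooth_imp_continuous[OF LP_cutoff_smooth, of \<phi> "[]" A] by simp

text \<open>The strict inequality makes the region open, so that a function vanishing on it has
  vanishing derivative there and the induction goes through.\<close>

lemma partial_deriv_LP_cutoff_eq_0:
  assumes "LP_cutoff \<phi>" "vs \<in> lists Basis" "1 < norm x"
  shows "partial_deriv vs \<phi> x = 0"
  using assms(2,3)
proof (induction vs arbitrary: x)
  case Nil
  then show ?case using assms(1) by (simp add: LP_cutoff_def)
next
  case (Cons v vs)
  have "((\<lambda>x. 0) has_derivative (\<lambda>h. 0)) (at x)"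
    by simp
  moreover have "open {y::'a. 1 < norm y}"
    by (intro open_Collect_less continuous_intros)
  ultimately have "(partial_deriv vs \<phi> has_derivative (\<lambda>h. 0)) (at x)"
    by (rule has_derivative_transform_within_open) (use Cons in auto)
  from frechet_derivative_at[OF this] show ?case
    by (metis partial_deriv.simps(2))
qed

text \<open>All test functions constructed in the proof are of this form. Every derivative vanishes
  outside the closed ball of radius 1/c about a, and on that compact ball continuity bounds
  it.\<close>

lemma LP_cutoff_schwartz:
  fixes \<phi> :: "'a::euclidean_space \<Rightarrow> real"
  assumes "LP_cutoff \<phi>" "0 < c"
  shows "(\<lambda>x. complex_of_real (\<phi> (c *\<^sub>R (x - a)))) \<in> schwartz"
  unfolding schwartz_def
proof (intro CollectI conjI allI ballI smooth_affine LP_cutoff_smooth assms)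
  fix k and vs :: "'a list" assume vs: "vs \<in> lists Basis"
  let ?F = "\<lambda>x. (1 + norm x) ^ k * norm (partial_deriv vs (\<lambda>x. complex_of_real (\<phi> (c *\<^sub>R (x - a)))) x)"
  have F: "?F = (\<lambda>x. (1 + norm x) ^ k * norm (complex_of_real (c ^ length vs * partial_deriv vs \<phi> (c *\<^sub>R (x - a)))))"
    by (simp only: partial_deriv_affine[OF LP_cutoff_smooth[OF assms(1)] vs])
  have "continuous_on (cball a (1 / c)) ?F"
  proof -
    have "continuous_on UNIV (partial_deriv vs \<phi>)"
      by (intro smooth_imp_continuous LP_cutoff_smooth[OF assms(1)] vs)
    then have "continuous_on (cball a (1 / c)) (\<lambda>x. partial_deriv vs \<phi> (c *\<^sub>R (x - a)))"
      by (rule continuous_on_compose2) (auto intro!: continuous_intros)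
    then show ?thesis
      unfolding F by (intro continuous_intros)
  qed
  then have "bdd_above (?F ` cball a (1 / c))"
    by (intro bounded_imp_bdd_above compact_imp_bounded compact_continuous_image compact_cball)
  then obtain B where "\<forall>y\<in>?F ` cball a (1 / c). y \<le> B"
    unfolding bdd_above_def by blast
  then have B: "x \<in> cball a (1 / c) \<Longrightarrow> ?F x \<le> B" for x
    by blast
  have "?F x \<le> max B 0" for x
  proof (cases "x \<in> cball a (1 / c)")
    case False
    then have "1 < norm (c *\<^sub>R (x - a))"
      using \<open>0 < c\<close> by (simp add: dist_norm norm_minus_commute not_le divide_less_eq mult.commute
        del: scaleR_right_diff_distrib)
    then have "?F x = 0"
      using fun_cong[OF F, of x] partial_deriv_LP_cutoff_eq_0[OF assms(1) vs, of "c *\<^sub>R (x - a)"]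
      by simp
    then show ?thesis by (metis max.cobounded2)
  qed (use B in \<open>blast intro: max.coboundedI1\<close>)
  then show "bdd_above (range ?F)"
    by (auto simp: bdd_above_def)
qed

section \<open>Integrals over boxes determine a function almost everywhere\<close>

text \<open>The positive and negative parts of f define measures that are finite and equal on boxes.
  Boxes are stable under intersection, generate the Borel sets and exhaust the space, so the
  measures coincide; hence so do the densities, and f^+ = f^- forces f = 0.\<close>

lemma AE_eq_0_if_box_integrals:
  fixes f :: "'a::euclidean_space \<Rightarrow> real"
  assumes [measurable]: "f \<in> borel_measurable lborel"
    and int: "\<And>l u. integrable lborel (\<lambda>x. indicator (box l u) x * f x)"
    and zero: "\<And>l u. (\<integral>x. indicator (box l u) x * f x \<partial>lborel) = 0"
  shows "AE x in lborel. f x = 0"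
proof -
  \<comment> \<open>Since \<open>ennreal\<close> sends negative numbers to 0, these two densities
    are the positive and the negative part of f.\<close>
  let ?M = "density lborel (\<lambda>x. ennreal (f x))" and ?N = "density lborel (\<lambda>x. ennreal (- f x))"
  let ?E = "range (\<lambda>(a, b). box a b::'a set)"
  let ?A = "\<lambda>n::nat. box (- (real n *\<^sub>R One)) (real n *\<^sub>R One) :: 'a set"
  have eq: "emeasure ?M (box l u) = emeasure ?N (box l u)" and fin: "emeasure ?M (box l u) \<noteq> \<infinity>" for l u :: 'a
  proof -
    let ?p = "\<integral>\<^sup>+x. ennreal (indicator (box l u) x * f x) \<partial>lborel"
    let ?n = "\<integral>\<^sup>+x. ennreal (- (indicator (box l u) x * f x)) \<partial>lborel"
    have p: "emeasure ?M (box l u) = ?p" and n: "emeasure ?N (box l u) = ?n"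
      by (auto simp: emeasure_density indicator_def intro!: nn_integral_cong)
    have "?p \<noteq> \<infinity>" "?n \<noteq> \<infinity>"
      using int[of l u] by (auto simp: real_integrable_def)
    moreover have "enn2real ?p - enn2real ?n = 0"
      using zero[of l u] by (simp add: real_lebesgue_integral_def[OF int])
    ultimately show "emeasure ?M (box l u) = emeasure ?N (box l u)" "emeasure ?M (box l u) \<noteq> \<infinity>"
      unfolding p n by (cases ?p; cases ?n; simp)+
  qed
  have "?M = ?N"
  proof (rule measure_eqI_generator_eq[where E = ?E and A = ?A and \<Omega> = UNIV])
    show "Int_stable ?E"
      by (auto simp: Int_stable_def box_Int_box)
    show "?E \<subseteq> Pow UNIV" "sets ?M = sigma_sets UNIV ?E" "sets ?N = sigma_sets UNIV ?E"
      by (simp_all add: borel_eq_box)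
    show "range ?A \<subseteq> ?E" "(\<Union>i. ?A i) = UNIV"
      unfolding UN_box_eq_UNIV by auto
  qed (use eq fin in auto)
  then have "AE x in lborel. ennreal (f x) = ennreal (- f x)"
    by (intro sigma_finite_measure.density_unique[OF sigma_finite_lborel]) auto
  then show ?thesis
  proof eventually_elim
    case (elim x)
    then show ?case
      by (cases "0 \<le> f x") (auto simp: ennreal_neg ennreal_eq_0_iff)
  qed
qed

text \<open>The right-hand side does not contain x: this makes the mass of the kernel a ->
  \<phi>(K(x - a)) the same for every x, so that a single constant normalises it.\<close>

lemma lborel_integral_reflect_translate:
  fixes F :: "'a::euclidean_space \<Rightarrow> real"
  assumes [measurable]: "F \<in> borel_measurable borel"
  shows "(\<integral>a. F (x - a) \<partial>lborel) = (\<integral>a. F (- a) \<partial>lborel)"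
proof -
  have "(\<integral>a. F (x - a) \<partial>lborel) = (\<integral>a. F (x - a) \<partial>distr lborel borel ((+) x))"
    by (simp add: lborel_distr_plus)
  also have "\<dots> = (\<integral>a. F (- a) \<partial>lborel)"
    by (subst integral_distr) auto
  finally show ?thesis .
qed

text \<open>The test functions are translates and dilates of the cutoff itself: averaging
  \<open>\<phi> (K (x - a))\<close> over \<open>a\<close> in the box gives, after normalisation, functions that
  converge to the indicator of the box off its boundary.\<close>

lemma box_integral_eq_0:
  fixes \<phi> :: "'a::euclidean_space \<Rightarrow> real" and h :: "'a \<Rightarrow> complex"
  assumes \<phi>: "LP_cutoff \<phi>" and [measurable]: "h \<in> borel_measurable lborel"
    and int: "\<And>u. u \<in> schwartz \<Longrightarrow> integrable lborel (\<lambda>x. h x * u x)"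
    and zero: "\<And>u. u \<in> schwartz \<Longrightarrow> (\<integral>x. h x * u x \<partial>lborel) = 0"
  shows "integrable lborel (\<lambda>x. indicator (box l u) x *\<^sub>R h x)"
    and "(\<integral>x. indicator (box l u) x *\<^sub>R h x \<partial>lborel) = 0"
proof -
  define S where "S = box l u"
  have [measurable]: "S \<in> sets borel" "\<And>R. cball (0::'a) R \<in> sets borel"
    by (simp_all add: S_def)
  have [measurable]: "\<phi> \<in> borel_measurable borel"
    using LP_cutoff_continuous[OF \<phi>] by (rule borel_measurable_continuous_onI)
  have nonneg: "0 \<le> \<phi> x" and one: "norm x \<le> 1/2 \<Longrightarrow> \<phi> x = 1" and out: "1 \<le> norm x \<Longrightarrow> \<phi> x = 0" for x
    using \<phi> by (auto simp: LP_cutoff_def)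
  obtain M where M: "0 < M" "\<And>x. \<phi> x \<le> M"
  proof -
    have "compact (\<phi> ` cball 0 1)"
      by (intro compact_continuous_image LP_cutoff_continuous[OF \<phi>] compact_cball)
    then have "bdd_above (\<phi> ` cball 0 1)"
      by (intro bounded_imp_bdd_above compact_imp_bounded)
    then obtain B where "\<forall>y\<in>\<phi> ` cball 0 1. y \<le> B"
      unfolding bdd_above_def by blast
    then have B: "x \<in> cball 0 1 \<Longrightarrow> \<phi> x \<le> B" for x
      by blast
    have "\<phi> x \<le> max B 1" for x
      using B[of x] out[of x] by (cases "norm x \<le> 1") auto
    then show ?thesis using that[of "max B 1"] by auto
  qed
  \<comment> \<open>Local integrability of h comes from testing against a wide dilate of the cutoff:
    the factor 1/(2R) sends the ball of radius R into the ball of radius 1/2, where \<phi> =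
    1.\<close>
  have loc: "integrable lborel (\<lambda>x. indicator (cball 0 R) x *\<^sub>R h x)" if "0 < R" for R
  proof (rule Bochner_Integration.integrable_bound)
    show "integrable lborel (\<lambda>x. h x * complex_of_real (\<phi> ((1 / (2 * R)) *\<^sub>R (x - 0))))"
      using that by (intro int LP_cutoff_schwartz[OF \<phi>]) auto
    show "AE x in lborel. norm (indicator (cball 0 R) x *\<^sub>R h x)
        \<le> norm (h x * complex_of_real (\<phi> ((1 / (2 * R)) *\<^sub>R (x - 0))))"
    proof (rule AE_I2)
      fix x
      have "\<phi> ((1 / (2 * R)) *\<^sub>R x) = 1" if "norm x \<le> R"
        using that \<open>0 < R\<close> by (intro one) (simp add: field_simps)
      then show "norm (indicator (cball 0 R) x *\<^sub>R h x)
        \<le> norm (h x * complex_of_real (\<phi> ((1 / (2 * R)) *\<^sub>R (x - 0))))"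
        by (auto simp: indicator_def norm_mult)
    qed
  qed measurable
  obtain R0 where R0: "0 < R0" "S \<subseteq> cball 0 R0"
    using bounded_box[of l u] unfolding S_def bounded_pos by (auto simp: subset_eq)
  show "integrable lborel (\<lambda>x. indicator (box l u) x *\<^sub>R h x)"
    using loc[OF R0(1)]
    by (rule Bochner_Integration.integrable_bound)
       (measurable, rule AE_I2, use R0 in \<open>auto simp: S_def indicator_def subset_eq\<close>)
  \<comment> \<open>The scales start at 1, so \<open>\<Phi> k x\<close> is supported in the unit
    ball about x for every k. All averages over the box therefore live in one ball of radius
    \<open>R0 + 1\<close>, which supplies the domination.\<close>
  define K where "K k = real (Suc k)" for k
  have K: "1 \<le> K k" "0 < K k" for k by (simp_all add: K_def)
  define \<Phi> where "\<Phi> k x a = \<phi> (K k *\<^sub>R (x - a))" for k x a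
  have [measurable]: "(\<lambda>(x, a). \<Phi> k x a) \<in> borel_measurable (borel \<Otimes>\<^sub>M borel)"
     "(\<lambda>a. \<Phi> k x a) \<in> borel_measurable borel" for k x
    unfolding \<Phi>_def by measurable
  have \<Phi>_supp: "\<Phi> k x a = 0" if "1 / K k \<le> norm (x - a)" for k x a
    using that K[of k] unfolding \<Phi>_def by (intro out) (simp add: pos_divide_le_eq mult.commute)
  have \<Phi>_le: "\<Phi> k x a \<le> M * indicator (cball x 1) a" for k x a
  proof (cases "a \<in> cball x 1")
    case False
    then have "1 \<le> norm (x - a)"
      by (simp add: dist_norm)
    moreover have "1 / K k \<le> 1"
      using K[of k] by simp
    ultimately have "1 / K k \<le> norm (x - a)"
      by linarith
    then show ?thesis using False \<Phi>_supp by simp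
  qed (use M in \<open>simp add: \<Phi>_def\<close>)
  have \<Phi>_int: "integrable lborel (\<Phi> k x)" for k x
  proof (rule Bochner_Integration.integrable_bound)
    show "integrable lborel (\<lambda>a. M * indicator (cball x 1) a)"
      by (intro integrable_mult_right integrable_real_indicator) (auto intro: emeasure_bounded_finite[unfolded infinity_ennreal_def])
  qed (use \<Phi>_le nonneg M in \<open>auto simp: \<Phi>_def\<close>)
  define c where "c k = (\<integral>a. \<Phi> k 0 a \<partial>lborel)" for k
  have c_eq: "(\<integral>a. \<Phi> k x a \<partial>lborel) = c k" for k x
    using lborel_integral_reflect_translate[of "\<lambda>z. \<phi> (K k *\<^sub>R z)" x] by (simp add: c_def \<Phi>_def)
  have c_pos: "0 < c k" for k
  proof -
    have "0 < measure lborel (cball (0::'a) (1 / (2 * K k)))"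
      using K[of k] by (intro content_cball_pos) auto
    also have "\<dots> = (\<integral>a. indicator (cball (0::'a) (1 / (2 * K k))) a \<partial>lborel)"
      by simp
    also have "\<dots> \<le> c k"
      unfolding c_def
    proof (intro integral_mono \<Phi>_int)
      fix a :: 'a
      have "\<Phi> k 0 a = 1" if "norm a \<le> 1 / (2 * K k)"
        unfolding \<Phi>_def using that K[of k] by (intro one) (simp add: field_simps)
      then show "indicator (cball 0 (1 / (2 * K k))) a \<le> \<Phi> k 0 a"
        using nonneg by (auto simp: indicator_def \<Phi>_def)
    qed (intro integrable_real_indicator, auto intro: emeasure_bounded_finite[unfolded infinity_ennreal_def])
    finally show ?thesis .
  qed
  \<comment> \<open>The normalised average over centres a in the box, that is, the indicator of the
    box mollified at scale \<open>1 / K k\<close>.\<close>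
  define G where "G k x = (\<integral>a. indicator S a * \<Phi> k x a \<partial>lborel) / c k" for k x
  have G_int: "integrable lborel (\<lambda>a. indicator S a * \<Phi> k x a)" for k x
    using \<Phi>_int[of k x] by (rule Bochner_Integration.integrable_bound) (auto simp: indicator_def)
  have G_nonneg: "0 \<le> G k x" for k x
    unfolding G_def using c_pos[of k] nonneg
    by (intro divide_nonneg_nonneg integral_nonneg_AE) (auto simp: \<Phi>_def intro: less_imp_le)
  have G_le: "G k x \<le> 1" for k x
  proof -
    have "(\<integral>a. indicator S a * \<Phi> k x a \<partial>lborel) \<le> (\<integral>a. \<Phi> k x a \<partial>lborel)"
      using nonneg by (intro integral_mono G_int \<Phi>_int) (auto simp: indicator_def \<Phi>_def)
    then show ?thesis using c_pos[of k] by (simp add: G_def c_eq)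
  qed
  have [measurable]: "G k \<in> borel_measurable borel" for k
    unfolding G_def by measurable
  have G_out: "G k x = 0" if "ball x (1 / K k) \<inter> S = {}" for k x
  proof -
    have "(\<lambda>a. indicator S a * \<Phi> k x a) = (\<lambda>a. 0)"
    proof
      fix a
      have "a \<in> S \<Longrightarrow> 1 / K k \<le> norm (x - a)"
        using that by (auto simp: dist_norm disjoint_iff not_less)
      then show "indicator S a * \<Phi> k x a = 0"
        using \<Phi>_supp by (auto simp: indicator_def)
    qed
    then show ?thesis by (simp add: G_def)
  qed
  have G_in: "G k x = 1" if "ball x (1 / K k) \<subseteq> S" for k x
  proof -
    have "(\<lambda>a. indicator S a * \<Phi> k x a) = \<Phi> k x"
    proof
      fix a
      have "a \<notin> S \<Longrightarrow> 1 / K k \<le> norm (x - a)"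
        using that by (auto simp: dist_norm subset_eq not_less)
      then show "indicator S a * \<Phi> k x a = \<Phi> k x a"
        using \<Phi>_supp by (auto simp: indicator_def)
    qed
    then show ?thesis using c_pos[of k] by (simp add: G_def c_eq)
  qed
  have small: "\<forall>\<^sub>F k in sequentially. 1 / K k < e" if "0 < e" for e
    using order_tendstoD(2)[OF LIMSEQ_inverse_real_of_nat that] by (simp add: K_def inverse_eq_divide)
  \<comment> \<open>Inside the open box and outside the closed one, a small ball about x stays on
    the same side, so the average is exactly 1 or 0 for large k. Only the boundary of the box
    remains, and it is a null set.\<close>
  have G_lim: "AE x in lborel. (\<lambda>k. G k x) \<longlonglongrightarrow> indicator S x"
  proof (rule AE_I'[OF null_sets_cbox_Diff_box[of l u]], rule subsetI)
    fix x assume x: "x \<in> {x \<in> space lborel. \<not> (\<lambda>k. G k x) \<longlonglongrightarrow> indicator S x}"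
    have "x \<in> cbox l u"
    proof (rule ccontr)
      assume "x \<notin> cbox l u"
      then obtain e where e: "0 < e" "ball x e \<subseteq> - cbox l u"
        using open_contains_ball[of "- cbox l u"] closed_cbox[of l u] by auto
      have "\<forall>\<^sub>F k in sequentially. G k x = indicator S x"
        using small[OF e(1)]
      proof eventually_elim
        case (elim k)
        have "ball x (1 / K k) \<subseteq> - cbox l u"
          by (rule order.trans[OF subset_ball[OF less_imp_le[OF elim]] e(2)])
        then show ?case
          using \<open>x \<notin> cbox l u\<close> box_subset_cbox[of l u] by (subst G_out) (auto simp: S_def indicator_def)
      qed
      then have "(\<lambda>k. G k x) \<longlonglongrightarrow> indicator S x"
        by (rule tendsto_eventually)
      then show False using x by simp
    qed
    moreover have "x \<notin> box l u"
    proof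
      assume "x \<in> box l u"
      then obtain e where e: "0 < e" "ball x e \<subseteq> box l u"
        using open_contains_ball[of "box l u"] open_box[of l u] by auto
      have "\<forall>\<^sub>F k in sequentially. G k x = indicator S x"
        using small[OF e(1)]
      proof eventually_elim
        case (elim k)
        have "ball x (1 / K k) \<subseteq> S"
          unfolding S_def by (rule order.trans[OF subset_ball[OF less_imp_le[OF elim]] e(2)])
        then show ?case
          using \<open>x \<in> box l u\<close> by (subst G_in) (auto simp: S_def indicator_def)
      qed
      then have "(\<lambda>k. G k x) \<longlonglongrightarrow> indicator S x"
        by (rule tendsto_eventually)
      then show False using x by simp
    qed
    ultimately show "x \<in> cbox l u - box l u" by simp
  qed
  have G_supp: "G k x = 0" if "x \<notin> cball 0 (R0 + 1)" for k x
  proof (rule G_out)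
    show "ball x (1 / K k) \<inter> S = {}"
    proof (rule ccontr)
      assume "ball x (1 / K k) \<inter> S \<noteq> {}"
      then obtain a where a: "norm (x - a) < 1 / K k" "a \<in> S"
        by (auto simp: dist_norm)
      have "1 / K k \<le> 1" using K[of k] by simp
      then have "norm x \<le> 1 + norm a"
        using a(1) norm_triangle_sub[of x a] by linarith
      then show False using that a(2) R0 by (auto simp: subset_eq)
    qed
  qed
  \<comment> \<open>Exchange the integrals: for fixed centre a the integral in x pairs h with a
    Schwartz function and is 0. Fubini applies because the average has bounded support and h is
    locally integrable.\<close>
  have G_zero: "(\<integral>x. G k x *\<^sub>R h x \<partial>lborel) = 0" for k
  proof -
    let ?f = "\<lambda>x a. (indicator S a * \<Phi> k x a) *\<^sub>R h x"
    have supp: "indicator S a * \<Phi> k x a = 0" if "x \<notin> cball 0 (R0 + 1)" for x a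
    proof (rule ccontr)
      assume *: "indicator S a * \<Phi> k x a \<noteq> 0"
      then have a: "a \<in> S" "norm (x - a) < 1 / K k"
        using \<Phi>_supp[of k x a] by (auto simp: indicator_def not_le[symmetric])
      have "1 / K k \<le> 1" using K[of k] by simp
      then have "norm x \<le> 1 + norm a"
        using a(2) norm_triangle_sub[of x a] by linarith
      then show False using that a(1) R0 by (auto simp: subset_eq)
    qed
    have "integrable (lborel \<Otimes>\<^sub>M lborel) (case_prod ?f)"
    proof (rule lborel_pair.Fubini_integrable)
      show "AE x in lborel. integrable lborel (\<lambda>a. case_prod ?f (x, a))"
        using G_int by (auto intro!: integrable_scaleR_left)
      have "(\<lambda>x. \<integral>a. norm (case_prod ?f (x, a)) \<partial>lborel) = (\<lambda>x. c k * G k x * norm (h x))"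
      proof
        fix x
        have "(\<integral>a. norm (case_prod ?f (x, a)) \<partial>lborel) = (\<integral>a. (indicator S a * \<Phi> k x a) * norm (h x) \<partial>lborel)"
          using nonneg by (intro Bochner_Integration.integral_cong) (auto simp: \<Phi>_def)
        also have "\<dots> = c k * G k x * norm (h x)"
          using c_pos[of k] by (simp add: G_def)
        finally show "(\<integral>a. norm (case_prod ?f (x, a)) \<partial>lborel) = c k * G k x * norm (h x)" .
      qed
      moreover have "integrable lborel (\<lambda>x. c k * G k x * norm (h x))"
      proof (rule Bochner_Integration.integrable_bound)
        show "integrable lborel (\<lambda>x. c k * norm (indicator (cball 0 (R0 + 1)) x *\<^sub>R h x))"
          using loc[of "R0 + 1"] R0 by (intro integrable_mult_right integrable_norm) auto
        show "AE x in lborel. norm (c k * G k x * norm (h x))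
            \<le> norm (c k * norm (indicator (cball 0 (R0 + 1)) x *\<^sub>R h x))"
        proof (rule AE_I2)
          fix x
          show "norm (c k * G k x * norm (h x)) \<le> norm (c k * norm (indicator (cball 0 (R0 + 1)) x *\<^sub>R h x))"
          proof (cases "x \<in> cball 0 (R0 + 1)")
            case True
            then show ?thesis
              using c_pos[of k] G_le[of k x] G_nonneg[of k x]
              by (auto simp: abs_mult intro!: mult_left_le_one_le)
          qed (use G_supp in simp)
        qed
      qed measurable
      ultimately show "integrable lborel (\<lambda>x. \<integral>a. norm (case_prod ?f (x, a)) \<partial>lborel)"
        by simp
    qed measurable
    then have "(\<integral>a. (\<integral>x. ?f x a \<partial>lborel) \<partial>lborel) = (\<integral>x. (\<integral>a. ?f x a \<partial>lborel) \<partial>lborel)"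
      by (rule lborel_pair.Fubini_integral)
    moreover have "(\<integral>x. ?f x a \<partial>lborel) = 0" for a
    proof -
      have "(\<integral>x. h x * complex_of_real (\<phi> (K k *\<^sub>R (x - a))) \<partial>lborel) = 0"
        using K[of k] by (intro zero LP_cutoff_schwartz[OF \<phi>]) auto
      moreover have "(\<integral>x. ?f x a \<partial>lborel) = (\<integral>x. indicator S a *\<^sub>R (h x * complex_of_real (\<phi> (K k *\<^sub>R (x - a)))) \<partial>lborel)"
        by (intro Bochner_Integration.integral_cong) (auto simp: \<Phi>_def scaleR_conv_of_real)
      ultimately show ?thesis
        by (simp only: integral_scaleR_right scaleR_zero_right)
    qed
    moreover have "(\<integral>a. ?f x a \<partial>lborel) = c k *\<^sub>R (G k x *\<^sub>R h x)" for x
      using c_pos[of k] G_int[of k x] by (simp add: G_def)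
    ultimately have "(\<integral>x. c k *\<^sub>R (G k x *\<^sub>R h x) \<partial>lborel) = 0"
      by simp
    then show ?thesis
      using c_pos[of k] by (simp only: integral_scaleR_right) simp
  qed
  have "(\<lambda>k. \<integral>x. G k x *\<^sub>R h x \<partial>lborel) \<longlonglongrightarrow> (\<integral>x. indicator S x *\<^sub>R h x \<partial>lborel)"
  proof (rule integral_dominated_convergence)
    show "integrable lborel (\<lambda>x. norm (indicator (cball 0 (R0 + 1)) x *\<^sub>R h x))"
      using loc[of "R0 + 1"] R0 by (intro integrable_norm) auto
    show "AE x in lborel. (\<lambda>k. G k x *\<^sub>R h x) \<longlonglongrightarrow> indicator S x *\<^sub>R h x"
      using G_lim by eventually_elim (intro tendsto_intros)
    show "AE x in lborel. norm (G k x *\<^sub>R h x) \<le> norm (indicator (cball 0 (R0 + 1)) x *\<^sub>R h x)" for k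
    proof (rule AE_I2)
      fix x
      show "norm (G k x *\<^sub>R h x) \<le> norm (indicator (cball 0 (R0 + 1)) x *\<^sub>R h x)"
      proof (cases "x \<in> cball 0 (R0 + 1)")
        case True
        then show ?thesis
          using G_le[of k x] G_nonneg[of k x] by (auto intro!: mult_left_le_one_le)
      qed (use G_supp in simp)
    qed
  qed measurable
  then show "(\<integral>x. indicator (box l u) x *\<^sub>R h x \<partial>lborel) = 0"
    by (simp add: G_zero LIMSEQ_const_iff S_def)
qed

text \<open>Real and imaginary parts of the difference have vanishing integrals over all boxes. The
  hypothesis \<open>LP_cutoff \<phi>\<close> serves as the supply of Schwartz functions.\<close>

lemma represents_unique:
  fixes \<phi> :: "'a::euclidean_space \<Rightarrow> real" and T :: "'a functional"
  assumes \<phi>: "LP_cutoff \<phi>" and g: "represents g T" "represents h T"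
  shows "AE x in lborel. g x = h x"
proof -
  have [measurable]: "g \<in> borel_measurable lborel" "h \<in> borel_measurable lborel"
    using g by (auto simp: represents_def)
  define f where "f x = g x - h x" for x
  have [measurable]: "f \<in> borel_measurable lborel" unfolding f_def by measurable
  have f: "integrable lborel (\<lambda>x. f x * u x)" "(\<integral>x. f x * u x \<partial>lborel) = 0" if "u \<in> schwartz" for u
    using g that unfolding represents_def f_def by (auto simp: left_diff_distrib)
  have box: "integrable lborel (\<lambda>x. indicator (box l u) x *\<^sub>R f x)" for l u
    by (rule box_integral_eq_0(1)[OF \<phi>]) (auto simp: f)
  have zero: "(\<integral>x. indicator (box l u) x *\<^sub>R f x \<partial>lborel) = 0" for l u
    by (rule box_integral_eq_0(2)[OF \<phi>]) (auto simp: f)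
  have "AE x in lborel. Re (f x) = 0"
    using integrable_Re[OF box] integral_Re[OF box] zero
    by (intro AE_eq_0_if_box_integrals) auto
  moreover have "AE x in lborel. Im (f x) = 0"
    using integrable_Im[OF box] integral_Im[OF box] zero
    by (intro AE_eq_0_if_box_integrals) auto
  ultimately show ?thesis
    by eventually_elim (simp add: f_def complex_eq_iff)
qed

lemma Lq_norm_cong:
  assumes [measurable]: "g \<in> borel_measurable lborel" "h \<in> borel_measurable lborel"
    and "AE x in lborel. g x = h x"
  shows "Lq_norm q g = Lq_norm q h"
proof -
  have "esssup lborel (\<lambda>x. ennreal (norm (g x))) = esssup lborel (\<lambda>x. ennreal (norm (h x)))"
    using assms(3) by (intro esssup_AE_cong) (auto elim!: eventually_mono)
  moreover have "(\<integral>\<^sup>+x. epowr (ennreal (norm (g x))) a \<partial>lborel) = (\<integral>\<^sup>+x. epowr (ennreal (norm (h x))) a \<partial>lborel)" for a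
    using assms(3) by (intro nn_integral_cong_AE) (auto elim!: eventually_mono)
  ultimately show ?thesis by (simp add: Lq_norm_def)
qed

text \<open>Uniqueness reduces the infimum to one almost everywhere class. Hence the norms for both
  exponents can be computed from the same representative, as the minimum of the two norms
  requires.\<close>

lemma Lq_norm_dist_eq:
  fixes \<phi> :: "'a::euclidean_space \<Rightarrow> real" and T :: "'a functional"
  assumes "LP_cutoff \<phi>" "represents g T"
  shows "Lq_norm_dist q T = Lq_norm q g"
proof -
  have eq: "Lq_norm q h = Lq_norm q g" if "represents h T" for h
    using that assms by (intro Lq_norm_cong represents_unique[OF assms(1)]) (auto simp: represents_def)
  show ?thesis
    unfolding Lq_norm_dist_def by (rule INF_eq_const) (use assms(2) eq in blast)+
qed

section \<open>The Littlewood-Paley series and its rearrangement\<close>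

text \<open>Nonnegative terms may be summed in any order. The enumeration makes series over the
  natural numbers available, for which termwise integration and comparison are used
  throughout.\<close>

lemma infsum_int_eq_suminf:
  fixes f :: "int \<Rightarrow> ennreal"
  shows "(\<Sum>\<^sub>\<infinity>j. f j) = (\<Sum>n. f (int_decode n))"
proof -
  have "(\<Sum>\<^sub>\<infinity>j. f j) = (\<Sum>\<^sub>\<infinity>n. f (int_decode n))"
    by (rule infsum_reindex_bij_betw[OF bij_int_decode, symmetric])
  also have "\<dots> = (\<Sum>n. f (int_decode n))"
    by (intro sums_unique has_sum_imp_sums has_sum_infsum nonneg_summable_on_complete) simp
  finally show ?thesis .
qed

text \<open>Links the two notions of sum: an unconditional sum over the integers is also the limit
  of the symmetric partial sums, which are the ones that the convergence assumption on the blocks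
  can reach.\<close>

lemma filterlim_int_symmetric_intervals:
  "filterlim (\<lambda>N. {- int N..int N}) (finite_subsets_at_top UNIV) sequentially"
  unfolding filterlim_finite_subsets_at_top
proof (intro allI impI)
  fix X :: "int set" assume X: "finite X \<and> X \<subseteq> UNIV"
  define m where "m = nat (Max (insert 0 (abs ` X)))"
  have "X \<subseteq> {- int N..int N}" if "m \<le> N" for N
  proof
    fix x assume "x \<in> X"
    then have "\<bar>x\<bar> \<le> Max (insert 0 (abs ` X))"
      using X by (intro Max_ge) auto
    then show "x \<in> {- int N..int N}"
      using that unfolding m_def by auto
  qed
  then show "\<forall>\<^sub>F N in sequentially. finite {- int N..int N} \<and> X \<subseteq> {- int N..int N} \<and> {- int N..int N} \<subseteq> UNIV"
    by (auto simp: eventually_sequentially)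
qed

lemma summable_on_int_if_suminf_finite:
  fixes f :: "int \<Rightarrow> complex"
  assumes "(\<Sum>n. ennreal (norm (f (int_decode n)))) < \<infinity>"
  shows "(\<lambda>j. norm (f j)) summable_on UNIV" "ennreal (\<Sum>\<^sub>\<infinity>j. norm (f j)) = (\<Sum>n. ennreal (norm (f (int_decode n))))"
proof -
  have s: "summable (\<lambda>n. norm (f (int_decode n)))"
    using assms by (intro summable_suminf_not_top) auto
  then have "(\<lambda>n. norm (f (int_decode n))) summable_on UNIV"
    by (intro summable_nonneg_imp_summable_on) auto
  then show "(\<lambda>j. norm (f j)) summable_on UNIV"
    using summable_on_reindex_bij_betw[OF bij_int_decode, of "\<lambda>j. norm (f j)"] by simp
  have "(\<Sum>\<^sub>\<infinity>j. norm (f j)) = (\<Sum>\<^sub>\<infinity>n. norm (f (int_decode n)))"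
    by (rule infsum_reindex_bij_betw[OF bij_int_decode, symmetric])
  also have "\<dots> = (\<Sum>n. norm (f (int_decode n)))"
    using \<open>(\<lambda>n. norm (f (int_decode n))) summable_on UNIV\<close>
    by (intro sums_unique has_sum_imp_sums has_sum_infsum)
  finally show "ennreal (\<Sum>\<^sub>\<infinity>j. norm (f j)) = (\<Sum>n. ennreal (norm (f (int_decode n))))"
    using s by (simp add: suminf_ennreal2)
qed

text \<open>The bound says that S, the sum of all |F j|, is integrable against every |u|. So S is
  finite almost everywhere, the series converges absolutely there, and dominated convergence with
  majorant S |u| carries the pairing with u from partial sums to the limit.\<close>

lemma LP_series_represents:
  fixes \<phi> :: "'a::euclidean_space \<Rightarrow> real" and F :: "int \<Rightarrow> 'a \<Rightarrow> complex"
  assumes \<phi>: "LP_cutoff \<phi>" and T: "LP_sum_converges \<phi> T"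
    and F: "\<And>j. represents (F j) (dyadic_block \<phi> j T)"
    and bound: "\<And>u. u \<in> schwartz \<Longrightarrow>
      (\<Sum>n. \<integral>\<^sup>+x. ennreal (norm (F (int_decode n) x)) * ennreal (norm (u x)) \<partial>lborel) < \<infinity>"
  obtains g where "represents g T"
    "AE x in lborel. ennreal (norm (g x)) \<le> (\<Sum>n. ennreal (norm (F (int_decode n) x)))"
proof -
  have [measurable]: "F j \<in> borel_measurable lborel" for j
    using F[of j] by (simp add: represents_def)
  define S where "S x = (\<Sum>n. ennreal (norm (F (int_decode n) x)))" for x
  have [measurable]: "S \<in> borel_measurable lborel"
    unfolding S_def by measurable
  have S_int: "(\<integral>\<^sup>+x. S x * ennreal (norm (u x)) \<partial>lborel) < \<infinity>" if u: "u \<in> schwartz" for u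
  proof -
    note [measurable] = schwartz_measurable[OF u]
    have "(\<integral>\<^sup>+x. S x * ennreal (norm (u x)) \<partial>lborel)
        = (\<integral>\<^sup>+x. (\<Sum>n. ennreal (norm (F (int_decode n) x)) * ennreal (norm (u x))) \<partial>lborel)"
      unfolding S_def by (simp add: ennreal_suminf_multc)
    also have "\<dots> = (\<Sum>n. \<integral>\<^sup>+x. ennreal (norm (F (int_decode n) x)) * ennreal (norm (u x)) \<partial>lborel)"
      by (rule nn_integral_suminf) measurable
    finally show ?thesis using bound[OF u] by simp
  qed
  have S_AE: "AE x in lborel. S x * ennreal (norm (u x)) \<noteq> \<infinity>" if u: "u \<in> schwartz" for u
  proof -
    note [measurable] = schwartz_measurable[OF u]
    show ?thesis
      using S_int[OF u] by (intro nn_integral_noteq_infinite) auto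
  qed
  \<comment> \<open>A dilate of the cutoff equal to 1 on a ball shows that S is finite almost
    everywhere on it; countably many such balls cover the space.\<close>
  have "AE x in lborel. \<forall>m::nat. norm x \<le> real (Suc m) \<longrightarrow> S x < \<infinity>"
    unfolding AE_all_countable
  proof
    fix m :: nat
    let ?c = "1 / (2 * real (Suc m))"
    let ?u = "\<lambda>x. complex_of_real (\<phi> (?c *\<^sub>R (x - 0)))"
    have "?u \<in> schwartz"
      by (intro LP_cutoff_schwartz[OF \<phi>]) auto
    from S_AE[OF this]
    show "AE x in lborel. norm x \<le> real (Suc m) \<longrightarrow> S x < \<infinity>"
    proof eventually_elim
      case (elim x)
      have "\<phi> (?c *\<^sub>R (x - 0)) = 1" if "norm x \<le> real (Suc m)"
      proof -
        have "norm (?c *\<^sub>R (x - 0)) \<le> 1 / 2"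
          using that by (simp add: divide_le_eq)
        then show ?thesis using \<phi> unfolding LP_cutoff_def by blast
      qed
      then show ?case using elim by (auto simp: less_top)
    qed
  qed
  then have S_fin: "AE x in lborel. S x < \<infinity>"
  proof eventually_elim
    case (elim x)
    obtain m where "norm x \<le> real m" using real_arch_simple by blast
    then have "norm x \<le> real (Suc m)" by simp
    then show ?case using elim by blast
  qed
  define P where "P N x = (\<Sum>j\<in>{- int N..int N}. F j x)" for N x
  have [measurable]: "P N \<in> borel_measurable lborel" for N
    unfolding P_def by measurable
  \<comment> \<open>Taking \<open>lim\<close> at every point keeps g measurable; the points without
    convergence lie in the null set where S is infinite.\<close>
  define g where "g x = lim (\<lambda>N. P N x)" for x
  have [measurable]: "g \<in> borel_measurable lborel"
    unfolding g_def by measurable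
  have P_lim: "(\<lambda>N. P N x) \<longlonglongrightarrow> g x" and P_le: "ennreal (norm (P N x)) \<le> S x" if "S x < \<infinity>" for x N
  proof -
    note abs = summable_on_int_if_suminf_finite[of "\<lambda>j. F j x", OF that[unfolded S_def]]
    have "((\<lambda>j. F j x) has_sum (\<Sum>\<^sub>\<infinity>j. F j x)) UNIV"
      by (rule has_sum_infsum[OF abs_summable_summable[OF abs(1)]])
    then have "(\<lambda>N. P N x) \<longlonglongrightarrow> (\<Sum>\<^sub>\<infinity>j. F j x)"
      unfolding P_def has_sum_def by (rule filterlim_compose[OF _ filterlim_int_symmetric_intervals])
    then show "(\<lambda>N. P N x) \<longlonglongrightarrow> g x"
      unfolding g_def convergent_LIMSEQ_iff[symmetric] by (rule convergentI)
    have "norm (P N x) \<le> (\<Sum>j\<in>{- int N..int N}. norm (F j x))"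
      unfolding P_def by (rule norm_sum)
    also have "\<dots> \<le> (\<Sum>\<^sub>\<infinity>j. norm (F j x))"
      using abs(1) by (intro finite_sum_le_infsum) auto
    finally show "ennreal (norm (P N x)) \<le> S x"
      unfolding S_def abs(2)[symmetric] by (rule ennreal_leI)
  qed
  have g_le: "ennreal (norm (g x)) \<le> S x" if "S x < \<infinity>" for x
    using P_le[OF that] by (intro LIMSEQ_le_const2[OF tendsto_ennrealI[OF tendsto_norm[OF P_lim[OF that]]]]) auto
  have "represents g T"
    unfolding represents_def
  proof (intro conjI ballI)
    fix u :: "'a \<Rightarrow> complex" assume u: "u \<in> schwartz"
    note [measurable] = schwartz_measurable[OF u]
    \<comment> \<open>A real-valued majorant, equal to S |u| wherever S is finite and thus almost
      everywhere.\<close>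
    define w where "w x = enn2real (S x) * norm (u x)" for x
    have [measurable]: "w \<in> borel_measurable lborel"
      unfolding w_def by measurable
    have w: "integrable lborel w"
    proof (rule integrableI_nonneg)
      have "(\<integral>\<^sup>+x. ennreal (w x) \<partial>lborel) = (\<integral>\<^sup>+x. S x * ennreal (norm (u x)) \<partial>lborel)"
        using S_fin by (intro nn_integral_cong_AE) (auto simp: w_def ennreal_mult elim!: eventually_mono)
      then show "(\<integral>\<^sup>+x. ennreal (w x) \<partial>lborel) < \<infinity>"
        using S_int[OF u] by simp
    qed (auto simp: w_def)
    have le_w: "norm (z * u x) \<le> w x" if "ennreal (norm z) \<le> S x" "S x < \<infinity>" for z x
    proof -
      have "norm z \<le> enn2real (S x)"
        using that by (metis enn2real_mono enn2real_ennreal norm_ge_zero infinity_ennreal_def)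
      then show ?thesis by (simp add: w_def norm_mult mult_right_mono)
    qed
    have lim: "(\<lambda>N. \<integral>x. P N x * u x \<partial>lborel) \<longlonglongrightarrow> (\<integral>x. g x * u x \<partial>lborel)"
      and int: "integrable lborel (\<lambda>x. g x * u x)"
    proof -
      have 1: "AE x in lborel. (\<lambda>N. P N x * u x) \<longlonglongrightarrow> g x * u x"
        using S_fin by eventually_elim (intro tendsto_intros P_lim)
      have 2: "AE x in lborel. norm (P N x * u x) \<le> w x" for N
        using S_fin by eventually_elim (intro le_w P_le)
      show "(\<lambda>N. \<integral>x. P N x * u x \<partial>lborel) \<longlonglongrightarrow> (\<integral>x. g x * u x \<partial>lborel)"
        by (rule integral_dominated_convergence[OF _ _ w 1 2]) measurable
      show "integrable lborel (\<lambda>x. g x * u x)"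
        by (rule integrable_dominated_convergence[OF _ _ w 1 2]) measurable
    qed
    show "integrable lborel (\<lambda>x. g x * u x)" by fact
    have "(\<integral>x. P N x * u x \<partial>lborel) = (\<Sum>j\<in>{- int N..int N}. dyadic_block \<phi> j T u)" for N
    proof -
      have "(\<integral>x. P N x * u x \<partial>lborel) = (\<Sum>j\<in>{- int N..int N}. \<integral>x. F j x * u x \<partial>lborel)"
        unfolding P_def sum_distrib_right
        using F u by (intro Bochner_Integration.integral_sum) (auto simp: represents_def)
      then show ?thesis
        using F u by (simp add: represents_def)
    qed
    \<comment> \<open>The symmetric partial sums form the diagonal M = N of the double
      limit.\<close>
    moreover have "(\<lambda>N. \<Sum>j\<in>{- int N..int N}. dyadic_block \<phi> j T u) \<longlonglongrightarrow> T u"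
    proof -
      have "((\<lambda>(M, N). \<Sum>j\<in>{- int M..int N}. dyadic_block \<phi> j T u) \<longlongrightarrow> T u) (sequentially \<times>\<^sub>F sequentially)"
        using T u by (simp add: LP_sum_converges_def)
      from filterlim_compose[OF this filterlim_Pair[OF filterlim_ident filterlim_ident]]
      show ?thesis by simp
    qed
    ultimately show "T u = (\<integral>x. g x * u x \<partial>lborel)"
      using lim LIMSEQ_unique by fastforce
  qed measurable
  moreover have "AE x in lborel. ennreal (norm (g x)) \<le> (\<Sum>n. ennreal (norm (F (int_decode n) x)))"
    using S_fin by eventually_elim (use g_le in \<open>simp add: S_def\<close>)
  ultimately show ?thesis using that by blast
qed

section \<open>Rearrangement of a dominated series\<close>

text \<open>Writing m^(1-1/q) = m m^(-1/q) and using s \<le> m leaves the factor m in front and only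
  s inside the minimum. The factor m then cancels against the lower bound t m for the integral of
  |g|.\<close>

lemma nn_integral_set_le_min_Lq_norm:
  fixes f :: "'a::euclidean_space \<Rightarrow> complex"
  assumes q: "1 \<le> q\<^sub>0" "1 \<le> q\<^sub>1" and [measurable]: "f \<in> borel_measurable lborel" "E \<in> sets lborel"
    and E: "emeasure lborel E = ennreal m" and s: "0 < s" "s \<le> m"
  shows "(\<integral>\<^sup>+y\<in>E. ennreal (norm (f y)) \<partial>lborel) \<le> ennreal (2 * m) *
    min (ennreal (s powr - enn2real (1 / q\<^sub>0)) * Lq_norm q\<^sub>0 f) (ennreal (s powr - enn2real (1 / q\<^sub>1)) * Lq_norm q\<^sub>1 f)"
proof -
  have *: "(\<integral>\<^sup>+y\<in>E. ennreal (norm (f y)) \<partial>lborel)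
      \<le> ennreal (2 * m) * (ennreal (s powr - enn2real (1 / q)) * Lq_norm q f)" if "1 \<le> q" for q
  proof -
    have "m powr (1 - enn2real (1 / q)) = m * m powr - enn2real (1 / q)"
      using s by (simp add: powr_diff powr_minus divide_inverse)
    also have "\<dots> \<le> m * s powr - enn2real (1 / q)"
      using s by (intro mult_left_mono powr_mono2') auto
    finally have "ennreal (2 * m powr (1 - enn2real (1 / q))) \<le> ennreal (2 * m) * ennreal (s powr - enn2real (1 / q))"
      using s by (subst ennreal_mult'[symmetric]) (auto intro!: ennreal_leI)
    then have "ennreal (2 * m powr (1 - enn2real (1 / q))) * Lq_norm q f
       \<le> ennreal (2 * m) * (ennreal (s powr - enn2real (1 / q)) * Lq_norm q f)"
      unfolding mult.assoc[symmetric] by (intro mult_right_mono) auto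
    then show ?thesis
      using nn_integral_set_le_Lq_norm[OF that \<open>f \<in> borel_measurable lborel\<close> \<open>E \<in> sets lborel\<close> E] s
      by (auto intro: order.trans)
  qed
  show ?thesis
    using *[OF q(1)] *[OF q(2)] by (simp add: min_def)
qed

text \<open>Let b be the right-hand side. If {|g| \<ge> t} had measure above s for some t > b,
  integration over a bounded part of measure m > s would give t m \<le> b m, a contradiction. For
  infinite b there is nothing to show.\<close>

lemma rearrangement_series_le:
  fixes g :: "'a::euclidean_space \<Rightarrow> complex" and F :: "nat \<Rightarrow> 'a \<Rightarrow> complex"
  assumes q: "1 \<le> q\<^sub>0" "1 \<le> q\<^sub>1"
    and [measurable]: "g \<in> borel_measurable lborel" "\<And>n. F n \<in> borel_measurable lborel"
    and g: "AE x in lborel. ennreal (norm (g x)) \<le> (\<Sum>n. ennreal (norm (F n x)))"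
    and s: "0 < s"
  shows "rearrangement g s \<le> 2 * (\<Sum>n. min (ennreal (s powr - enn2real (1 / q\<^sub>0)) * Lq_norm q\<^sub>0 (F n))
    (ennreal (s powr - enn2real (1 / q\<^sub>1)) * Lq_norm q\<^sub>1 (F n)))"
    (is "_ \<le> 2 * (\<Sum>n. ?m n)")
proof (cases "2 * (\<Sum>n. ?m n)")
  case (real b)
  have dist: "distribution_fun g t \<le> ennreal s" if t: "b < t" for t
  proof (rule ccontr)
    assume "\<not> distribution_fun g t \<le> ennreal s"
    then have gt: "ennreal s < distribution_fun g t" by simp
    \<comment> \<open>The level set may have infinite measure. Intersections with large balls have
      finite measure and, by continuity from below, eventually exceed s.\<close>
    define E where "E k = {x. t \<le> norm (g x)} \<inter> ball 0 (real k)" for k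
    have [measurable]: "\<And>k. E k \<in> sets lborel"
      unfolding E_def by measurable
    have "(\<Union>k. E k) = {x. t \<le> norm (g x)}"
      using reals_Archimedean2 by (auto simp: E_def)
    then have "(SUP k. emeasure lborel (E k)) = distribution_fun g t"
      unfolding distribution_fun_def by (subst SUP_emeasure_incseq) (auto simp: incseq_def E_def)
    with gt obtain k where k: "ennreal s < emeasure lborel (E k)"
      by (metis less_SUP_iff)
    have "emeasure lborel (E k) < \<infinity>"
      by (intro emeasure_bounded_finite bounded_subset[OF bounded_ball]) (auto simp: E_def)
    then obtain m where m: "emeasure lborel (E k) = ennreal m" "0 \<le> m"
      by (cases "emeasure lborel (E k)") auto
    have sm: "s < m" using k m s by (simp add: ennreal_less_iff)
    have "ennreal (t * m) = (\<integral>\<^sup>+x\<in>E k. ennreal t \<partial>lborel)"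
      using m real t \<open>E k \<in> sets lborel\<close> by (subst nn_integral_cmult_indicator) (auto simp: ennreal_mult)
    also have "\<dots> \<le> (\<integral>\<^sup>+x. (\<Sum>n. ennreal (norm (F n x)) * indicator (E k) x) \<partial>lborel)"
      using g
    proof (intro nn_integral_mono_AE, eventually_elim)
      case (elim x)
      show ?case
      proof (cases "x \<in> E k")
        case True
        then have "ennreal t \<le> ennreal (norm (g x))"
          by (auto simp: E_def intro: ennreal_leI)
        then have "ennreal t \<le> (\<Sum>n. ennreal (norm (F n x)))"
          by (rule order.trans[OF _ elim(2)])
        then show ?thesis using True by simp
      qed simp
    qed
    also have "\<dots> = (\<Sum>n. \<integral>\<^sup>+x\<in>E k. ennreal (norm (F n x)) \<partial>lborel)"
      by (rule nn_integral_suminf) measurable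
    also have "\<dots> \<le> (\<Sum>n. ennreal (2 * m) * ?m n)"
      using sm s m \<open>E k \<in> sets lborel\<close> by (intro suminf_le nn_integral_set_le_min_Lq_norm q) auto
    also have "\<dots> = ennreal m * (2 * (\<Sum>n. ?m n))"
      using m by (simp add: ennreal_mult' ac_simps)
    also have "\<dots> = ennreal (b * m)"
      using real m by (simp add: ennreal_mult' mult.commute)
    finally have "t * m \<le> b * m"
      using real m by (simp add: ennreal_le_iff)
    then show False using t sm s by (simp add: mult_le_cancel_right)
  qed
  show ?thesis
  \<comment> \<open>The measure bound \<open>dist\<close> holds for t strictly above b, so b + e is
    the admissible competitor in the infimum.\<close>
  proof (rule ennreal_le_epsilon)
    fix e :: real assume "0 < e"
    then have "rearrangement g s \<le> ennreal (b + e)"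
      unfolding rearrangement_def using real dist[of "b + e"]
      by (intro Inf_lower CollectI exI[of _ "b + e"]) (simp del: ennreal_plus)
    then show "rearrangement g s \<le> 2 * (\<Sum>n. ?m n) + ennreal e"
      using real \<open>0 < e\<close> by simp
  qed
qed simp

section \<open>The interpolation kernel\<close>

definition lp_kernel :: "real \<Rightarrow> real \<Rightarrow> real \<Rightarrow> real" where
  "lp_kernel \<alpha> \<beta> x = min (x powr \<alpha>) (x powr - \<beta>)"

lemma lp_kernel_nonneg [simp]: "0 \<le> lp_kernel \<alpha> \<beta> x"
  by (simp add: lp_kernel_def)

lemma suminf_geometric_powr_finite:
  assumes "0 < (a::real)"
  shows "(\<Sum>n. ennreal (2 powr - (real n * a))) < \<infinity>"
proof -
  have eq: "2 powr - (real n * a) = (2 powr - a) ^ n" for n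
    by (simp add: powr_realpow[symmetric] powr_powr mult.commute)
  have "2 powr - a < (1::real)"
    using assms by (simp add: powr_less_one)
  then have "summable (\<lambda>n. (2 powr - a) ^ n)"
    by (intro summable_geometric) simp
  then show ?thesis
    unfolding eq by (subst suminf_ennreal2) auto
qed

text \<open>With J the integer part of log_2 x, the argument x 2^(-j) lies between 2^(J-j) and
  2^(J-j+1). The kernel is then at most h(J-j) for a fixed summable h, and the sum over all integers
  does not see the shift by J.\<close>

lemma suminf_lp_kernel_bounded:
  assumes "0 < \<alpha>" "0 < \<beta>"
  obtains K where "0 < K" "\<And>x. 0 < x \<Longrightarrow>
    (\<Sum>n. ennreal (lp_kernel \<alpha> \<beta> (x * 2 powr - real_of_int (int_decode n)))) \<le> ennreal K"
proof -
  \<comment> \<open>For i \<ge> 0 the decreasing power is evaluated at the lower endpoint 2^i, for i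
    < 0 the increasing one at the upper endpoint 2^(i+1). The substitution i = -1 - n turns the
    negative half into a geometric series starting with 1.\<close>
  define h where "h i = ennreal (if 0 \<le> i then 2 powr - (real_of_int i * \<beta>) else 2 powr (real_of_int (i + 1) * \<alpha>))"
    for i :: int
  have "(\<Sum>\<^sub>\<infinity>i. h i) = (\<Sum>\<^sub>\<infinity>i\<in>{0..} \<union> {..<0}. h i)"
    by (intro infsum_cong_neutral) auto
  also have "\<dots> = (\<Sum>\<^sub>\<infinity>i\<in>{0..}. h i) + (\<Sum>\<^sub>\<infinity>i\<in>{..<0}. h i)"
    by (intro infsum_Un_disjoint nonneg_summable_on_complete) auto
  also have "(\<Sum>\<^sub>\<infinity>i\<in>{0..}. h i) = (\<Sum>\<^sub>\<infinity>n::nat. h (int n))"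
    by (intro infsum_reindex_bij_betw[symmetric] bij_betwI[where g = nat]) auto
  also have "(\<Sum>\<^sub>\<infinity>i\<in>{..<0}. h i) = (\<Sum>\<^sub>\<infinity>n::nat. h (- 1 - int n))"
    by (intro infsum_reindex_bij_betw[symmetric] bij_betwI[where g = "\<lambda>i. nat (- 1 - i)"]) auto
  also have "(\<Sum>\<^sub>\<infinity>n::nat. h (int n)) = (\<Sum>n. ennreal (2 powr - (real n * \<beta>)))"
    unfolding h_def
    by (subst sums_unique[OF has_sum_imp_sums[OF has_sum_infsum[OF nonneg_summable_on_complete]]]) auto
  also have "(\<Sum>\<^sub>\<infinity>n::nat. h (- 1 - int n)) = (\<Sum>n. ennreal (2 powr - (real n * \<alpha>)))"
    unfolding h_def
    by (subst sums_unique[OF has_sum_imp_sums[OF has_sum_infsum[OF nonneg_summable_on_complete]]]) auto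
  finally have "(\<Sum>\<^sub>\<infinity>i. h i) < \<infinity>"
    using suminf_geometric_powr_finite[OF assms(1)] suminf_geometric_powr_finite[OF assms(2)] by simp
  then obtain K where K: "(\<Sum>\<^sub>\<infinity>i. h i) = ennreal K" "0 \<le> K"
    by (cases "\<Sum>\<^sub>\<infinity>i. h i") auto
  \<comment> \<open>K is known only to be nonnegative here; adding 1 yields a positive
    constant.\<close>
  have "(\<Sum>n. ennreal (lp_kernel \<alpha> \<beta> (x * 2 powr - real_of_int (int_decode n)))) \<le> ennreal (K + 1)"
    if "0 < x" for x
  proof -
    define J where "J = \<lfloor>log 2 x\<rfloor>"
    have "real_of_int J \<le> log 2 x" "log 2 x \<le> real_of_int J + 1"
      unfolding J_def by linarith+
    then have J: "2 powr real_of_int J \<le> x" "x \<le> 2 powr (real_of_int J + 1)"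
      using that by (simp_all add: le_log_iff log_le_iff)
    have le: "ennreal (lp_kernel \<alpha> \<beta> (x * 2 powr - real_of_int j)) \<le> h (J - j)" for j
    proof -
      let ?X = "x * 2 powr - real_of_int j"
      have "2 powr real_of_int J * 2 powr - real_of_int j \<le> ?X"
        using J by (intro mult_right_mono) auto
      then have 1: "2 powr real_of_int (J - j) \<le> ?X"
        by (simp add: powr_diff powr_minus divide_inverse)
      have "?X \<le> 2 powr (real_of_int J + 1) * 2 powr - real_of_int j"
        using J by (intro mult_right_mono) auto
      then have 2: "?X \<le> 2 powr real_of_int (J - j + 1)"
        by (simp add: powr_add[symmetric] algebra_simps)
      have 3: "?X powr - \<beta> \<le> (2 powr real_of_int (J - j)) powr - \<beta>"
        using 1 assms by (intro powr_mono2') auto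
      have 4: "?X powr \<alpha> \<le> (2 powr real_of_int (J - j + 1)) powr \<alpha>"
        using 2 assms that by (intro powr_mono2) auto
      show ?thesis
        using 3 4 unfolding h_def lp_kernel_def powr_powr by (intro ennreal_leI) auto
    qed
    have "(\<Sum>n. ennreal (lp_kernel \<alpha> \<beta> (x * 2 powr - real_of_int (int_decode n)))) \<le> (\<Sum>n. h (J - int_decode n))"
      by (intro suminf_le le) auto
    also have "\<dots> = (\<Sum>\<^sub>\<infinity>j. h (J - j))"
      by (rule infsum_int_eq_suminf[symmetric])
    also have "\<dots> = (\<Sum>\<^sub>\<infinity>i. h i)"
      by (rule infsum_reindex_bij_betw, rule bij_betwI[where g = "\<lambda>i. J - i"]) auto
    also have "\<dots> \<le> ennreal (K + 1)"
      using K by (simp add: ennreal_leI)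
    finally show ?thesis .
  qed
  then show ?thesis
    by (rule that[rotated]) (use K in auto)
qed

text \<open>Below \<open>s\<^sub>0\<close> the kernel is bounded by its increasing power and above
  by its decreasing one, which leaves two elementary integrals with values 1/a and 1/b. As ds/s is
  invariant under scaling, \<open>s\<^sub>0\<close> drops out.\<close>

lemma nn_integral_lp_kernel_le:
  assumes "0 < a" "0 < b" "0 < s\<^sub>0"
  shows "(\<integral>\<^sup>+s\<in>{0<..}. (ennreal (lp_kernel a b (s / s\<^sub>0)) / ennreal s) \<partial>lborel) \<le> ennreal (1 / a + 1 / b)"
proof -
  have "(\<integral>\<^sup>+s\<in>{0<..}. (ennreal (lp_kernel a b (s / s\<^sub>0)) / ennreal s) \<partial>lborel)
    \<le> (\<integral>\<^sup>+s. ennreal (s\<^sub>0 powr - a) * (indicator {0..s\<^sub>0} s * ennreal (s powr (a - 1)))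
        + ennreal (s\<^sub>0 powr b) * (indicator {s\<^sub>0..} s * ennreal (s powr (- b - 1))) \<partial>lborel)"
  proof (rule nn_integral_mono)
    fix s :: real
    show "ennreal (lp_kernel a b (s / s\<^sub>0)) / ennreal s * indicator {0<..} s
      \<le> ennreal (s\<^sub>0 powr - a) * (indicator {0..s\<^sub>0} s * ennreal (s powr (a - 1)))
        + ennreal (s\<^sub>0 powr b) * (indicator {s\<^sub>0..} s * ennreal (s powr (- b - 1)))"
    proof (cases "0 < s")
      case True
      have A: "(s / s\<^sub>0) powr a / s = s\<^sub>0 powr - a * s powr (a - 1)"
        using True assms by (simp add: powr_divide powr_diff powr_minus divide_simps)
      have B: "(s / s\<^sub>0) powr - b / s = s\<^sub>0 powr b * s powr (- b - 1)"
        using True assms by (simp add: powr_divide powr_diff powr_minus divide_simps)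
      have C: "ennreal (lp_kernel a b (s / s\<^sub>0)) / ennreal s = ennreal (lp_kernel a b (s / s\<^sub>0) / s)"
        using True by (simp add: divide_ennreal)
      have le: "lp_kernel a b (s / s\<^sub>0) / s \<le> s\<^sub>0 powr - a * s powr (a - 1)"
        "lp_kernel a b (s / s\<^sub>0) / s \<le> s\<^sub>0 powr b * s powr (- b - 1)"
        unfolding A[symmetric] B[symmetric] lp_kernel_def using True by (auto intro!: divide_right_mono)
      show ?thesis
      proof (cases "s \<le> s\<^sub>0")
        case le0: True
        have "ennreal (lp_kernel a b (s / s\<^sub>0) / s) \<le> ennreal (s\<^sub>0 powr - a) * ennreal (s powr (a - 1))"
          using le(1) by (subst ennreal_mult'[symmetric]) (auto intro: ennreal_leI)
        then show ?thesis
          using le0 True unfolding C by (auto intro: add_increasing2)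
      next
        case le0: False
        have "ennreal (lp_kernel a b (s / s\<^sub>0) / s) \<le> ennreal (s\<^sub>0 powr b) * ennreal (s powr (- b - 1))"
          using le(2) by (subst ennreal_mult'[symmetric]) (auto intro: ennreal_leI)
        then show ?thesis
          using le0 True unfolding C by (auto intro: add_increasing)
      qed
    qed simp
  qed
  also have "\<dots> = ennreal (s\<^sub>0 powr - a) * (\<integral>\<^sup>+s. indicator {0..s\<^sub>0} s * ennreal (s powr (a - 1)) \<partial>lborel)
        + ennreal (s\<^sub>0 powr b) * (\<integral>\<^sup>+s. indicator {s\<^sub>0..} s * ennreal (s powr (- b - 1)) \<partial>lborel)"
    by (simp add: nn_integral_add nn_integral_cmult)
  also have "(\<integral>\<^sup>+s. indicator {0..s\<^sub>0} s * ennreal (s powr (a - 1)) \<partial>lborel) = ennreal (s\<^sub>0 powr a / a)"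
  proof -
    have "((\<lambda>s. s powr (a - 1)) has_integral (s\<^sub>0 powr a / a)) {0..s\<^sub>0}"
      using has_integral_powr_from_0[of "a - 1" s\<^sub>0] assms by simp
    from nn_integral_has_integral_lebesgue[OF _ this] show ?thesis
      by (simp add: ennreal_indicator ennreal_mult')
  qed
  also have "(\<integral>\<^sup>+s. indicator {s\<^sub>0..} s * ennreal (s powr (- b - 1)) \<partial>lborel) = ennreal (s\<^sub>0 powr - b / b)"
  proof -
    have "((\<lambda>s. s powr (- b - 1)) has_integral (s\<^sub>0 powr - b / b)) {s\<^sub>0..}"
      using has_integral_powr_to_inf[of "- b - 1" s\<^sub>0] assms by simp
    from nn_integral_has_integral_lebesgue[OF _ this] show ?thesis
      by (simp add: ennreal_indicator ennreal_mult')
  qed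
  also have "ennreal (s\<^sub>0 powr - a) * ennreal (s\<^sub>0 powr a / a) + ennreal (s\<^sub>0 powr b) * ennreal (s\<^sub>0 powr - b / b)
    = ennreal (1 / a + 1 / b)"
    using assms by (simp add: ennreal_mult'[symmetric] powr_minus)
  finally show ?thesis .
qed

text \<open>With \<open>s\<^sub>0\<close> = c^(-1/\<gamma>) one has c s^\<gamma> = (s /
  \<open>s\<^sub>0\<close>)^\<gamma>, so \<gamma> is absorbed into the two exponents, which exchange
  their roles when \<gamma> < 0. The bound depends on |\<gamma>| and not on c; in the application
  \<gamma> \<noteq> 0 expresses that the Lebesgue exponents differ.\<close>

lemma nn_integral_lp_kernel_bounded:
  assumes "0 < \<alpha>" "0 < \<beta>" "\<gamma> \<noteq> 0"
  obtains K where "0 < K" "\<And>c. 0 < c \<Longrightarrow>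
    (\<integral>\<^sup>+s\<in>{0<..}. (ennreal (lp_kernel \<alpha> \<beta> (c * s powr \<gamma>)) / ennreal s) \<partial>lborel) \<le> ennreal K"
proof -
  have "(\<integral>\<^sup>+s\<in>{0<..}. (ennreal (lp_kernel \<alpha> \<beta> (c * s powr \<gamma>)) / ennreal s) \<partial>lborel)
    \<le> ennreal (1 / (\<bar>\<gamma>\<bar> * \<alpha>) + 1 / (\<bar>\<gamma>\<bar> * \<beta>))" if c: "0 < c" for c
  proof -
    define s\<^sub>0 where "s\<^sub>0 = c powr (- 1 / \<gamma>)"
    have s0: "0 < s\<^sub>0" "c = s\<^sub>0 powr - \<gamma>"
      using c assms by (auto simp: s\<^sub>0_def powr_powr)
    have eq: "c * s powr \<gamma> = (s / s\<^sub>0) powr \<gamma>" if "0 < s" for s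
      using s0 that by (simp add: powr_divide powr_minus_divide)
    have I: "(\<integral>\<^sup>+s\<in>{0<..}. (ennreal (lp_kernel \<alpha> \<beta> (c * s powr \<gamma>)) / ennreal s) \<partial>lborel)
      = (\<integral>\<^sup>+s\<in>{0<..}. (ennreal (lp_kernel a b (s / s\<^sub>0)) / ennreal s) \<partial>lborel)"
      if "\<And>s. 0 < s \<Longrightarrow> lp_kernel \<alpha> \<beta> ((s / s\<^sub>0) powr \<gamma>) = lp_kernel a b (s / s\<^sub>0)" for a b
      using that by (intro nn_integral_cong) (auto simp: indicator_def eq)
    show ?thesis
    proof (cases "0 < \<gamma>")
      case True
      show ?thesis
        by (subst I[of "\<gamma> * \<alpha>" "\<gamma> * \<beta>"])
           (use nn_integral_lp_kernel_le[of "\<gamma> * \<alpha>" "\<gamma> * \<beta>" s\<^sub>0] True assms s0 in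
             \<open>auto simp: lp_kernel_def powr_powr\<close>)
    next
      case False
      show ?thesis
        by (subst I[of "- \<gamma> * \<beta>" "- \<gamma> * \<alpha>"])
           (use nn_integral_lp_kernel_le[of "- \<gamma> * \<beta>" "- \<gamma> * \<alpha>" s\<^sub>0] False assms s0 in
             \<open>auto simp: lp_kernel_def powr_powr mult_neg_pos min.commute add.commute\<close>)
    qed
  qed
  moreover have "0 < 1 / (\<bar>\<gamma>\<bar> * \<alpha>) + 1 / (\<bar>\<gamma>\<bar> * \<beta>)"
    using assms by (intro add_pos_pos) auto
  ultimately show ?thesis using that by blast
qed

text \<open>Takes the place of Jensen's inequality for weights of total mass at most K; the
  splitting argument costs the factor 2^\<rho>.\<close>

lemma epowr_suminf_weighted_le:
  fixes w d :: "nat \<Rightarrow> ennreal"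
  assumes \<rho>: "1 \<le> \<rho>" and K: "0 < K" and w: "(\<Sum>n. w n) \<le> ennreal K"
  shows "epowr (\<Sum>n. d n * w n) \<rho> \<le> ennreal (2 powr \<rho> * K powr (\<rho> - 1)) * (\<Sum>n. epowr (d n) \<rho> * w n)"
proof (rule ennreal_le_scaled_limit)
  fix N :: real assume N: "0 < N" "(\<Sum>n. epowr (d n) \<rho> * w n) \<le> ennreal N"
  \<comment> \<open>Balances the two terms: l^\<rho> = N / K makes both l K and l^(1-\<rho>) N equal
    to l K.\<close>
  define l where "l = (N / K) powr (1 / \<rho>)"
  have l: "0 < l" using N K by (simp add: l_def)
  have lp: "l powr \<rho> = N / K" using N K \<rho> by (simp add: l_def powr_powr)
  have lN: "l powr (1 - \<rho>) * N = l * K"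
    using l lp N K by (simp add: powr_diff)
  have "(\<Sum>n. d n * w n) \<le> ennreal l * (\<Sum>n. w n) + ennreal (l powr (1 - \<rho>)) * (\<Sum>n. epowr (d n) \<rho> * w n)"
    using nn_integral_mult_le_epowr[OF l \<rho>, of d "count_space UNIV" w] by (simp add: nn_integral_count_space_nat)
  also have "\<dots> \<le> ennreal l * ennreal K + ennreal (l powr (1 - \<rho>)) * ennreal N"
    by (intro add_mono mult_left_mono w N) auto
  also have "\<dots> = ennreal (2 * l * K)"
    using l K N lN by (simp add: ennreal_mult'[symmetric] flip: ennreal_plus)
  finally have "epowr (\<Sum>n. d n * w n) \<rho> \<le> epowr (ennreal (2 * l * K)) \<rho>"
    using \<rho> by (intro epowr_mono) auto
  also have "\<dots> = ennreal (2 powr \<rho> * K powr (\<rho> - 1) * N)"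
    using l K lp by (simp add: epowr_ennreal powr_mult powr_diff mult.commute mult.left_commute)
  finally show "epowr (\<Sum>n. d n * w n) \<rho> \<le> ennreal (2 powr \<rho> * K powr (\<rho> - 1)) * ennreal N"
    using N by (simp add: ennreal_mult')
qed (use K in \<open>auto simp: ennreal_less_zero_iff\<close>)

section \<open>Lorentz norm of the sum\<close>

text \<open>Sequences indexed by the integers are enumerated along \<^const>\<open>int_decode\<close>.\<close>

definition lr_norm_le :: "ennreal \<Rightarrow> (nat \<Rightarrow> ennreal) \<Rightarrow> real \<Rightarrow> bool" where
  "lr_norm_le r a A \<longleftrightarrow>
     (if r = \<infinity> then \<forall>n. a n \<le> ennreal A
      else (\<Sum>n. epowr (a n) (enn2real r)) \<le> ennreal (A powr enn2real r))"

text \<open>For every r this leaves a uniform bound on the terms, which is all that the existence of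
  the representing functions and of their sum requires.\<close>

lemma lr_norm_le_imp_le:
  assumes "1 \<le> r" "0 < A" "lr_norm_le r a A"
  shows "a n \<le> ennreal A"
proof (cases "r = \<infinity>")
  case False
  define \<rho> where "\<rho> = enn2real r"
  have \<rho>: "1 \<le> \<rho>" using inverse_exponent False assms(1) unfolding \<rho>_def by blast
  have "epowr (a n) \<rho> \<le> (\<Sum>n. epowr (a n) \<rho>)"
    using sum_le_suminf[of "\<lambda>n. epowr (a n) \<rho>" "{n}"] by simp
  also have "\<dots> \<le> ennreal (A powr \<rho>)"
    using assms False by (simp add: lr_norm_le_def \<rho>_def)
  finally have "epowr (epowr (a n) \<rho>) (1 / \<rho>) \<le> epowr (ennreal (A powr \<rho>)) (1 / \<rho>)"
    using \<rho> by (intro epowr_mono) auto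
  then show ?thesis
    using \<rho> assms by (simp add: epowr_epowr epowr_ennreal powr_powr)
qed (use assms in \<open>simp add: lr_norm_le_def\<close>)

lemma besov_seminorm_le_imp_lr_norm_le:
  assumes "1 \<le> r" "0 < A" "besov_seminorm \<phi> s q r T \<le> ennreal A"
  shows "lr_norm_le r (\<lambda>n. ennreal (2 powr (real_of_int (int_decode n) * s)) *
    Lq_norm_dist q (dyadic_block \<phi> (int_decode n) T)) A"
proof (cases "r = \<infinity>")
  case True
  have "ennreal (2 powr (real_of_int j * s)) * Lq_norm_dist q (dyadic_block \<phi> j T) \<le> ennreal A" for j
    using assms(3) True unfolding besov_seminorm_def by (simp add: SUP_le_iff)
  then show ?thesis using True by (simp add: lr_norm_le_def)
next
  case False
  define \<rho> where "\<rho> = enn2real r"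
  have \<rho>: "1 \<le> \<rho>" using inverse_exponent False assms(1) unfolding \<rho>_def by blast
  define S where "S = (\<Sum>\<^sub>\<infinity>j::int. ennreal (2 powr (real_of_int j * s * \<rho>)) * epowr (Lq_norm_dist q (dyadic_block \<phi> j T)) \<rho>)"
  have "epowr S (1 / \<rho>) \<le> ennreal A"
    using assms(3) False by (simp add: besov_seminorm_def S_def \<rho>_def)
  then have "epowr (epowr S (1 / \<rho>)) \<rho> \<le> epowr (ennreal A) \<rho>"
    using \<rho> by (intro epowr_mono) auto
  then have "S \<le> ennreal (A powr \<rho>)"
    using \<rho> assms by (simp add: epowr_epowr epowr_ennreal)
  then show ?thesis
    using False \<rho> unfolding S_def infsum_int_eq_suminf
    by (simp add: lr_norm_le_def epowr_mult epowr_ennreal powr_powr flip: \<rho>_def)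
qed

text \<open>The exponent \<gamma> is chosen so that 1/p exceeds \<open>\<kappa>\<^sub>0\<close> by
  \<gamma>\<alpha> and falls short of \<open>\<kappa>\<^sub>1\<close> by \<gamma>\<beta>. With X = c
  s^\<gamma> 2^(-j), the two members of the minimum become the weighted norms times X^\<alpha> and
  X^(-\<beta>). Each \<kappa> stands for a reciprocal 1/q, so an infinite exponent is simply
  \<kappa> = 0.\<close>

lemma min_le_max_mult_lp_kernel:
  fixes N\<^sub>0 N\<^sub>1 :: ennreal
  assumes \<alpha>: "0 < \<alpha>" and \<beta>: "0 < \<beta>" and s: "0 < s" and c: "0 < c"
    and \<theta>: "\<theta> = \<alpha> / (\<alpha> + \<beta>)" and p: "1 / p = (1 - \<theta>) * \<kappa>\<^sub>0 + \<theta> * \<kappa>\<^sub>1"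
    and \<gamma>: "\<gamma> = (\<kappa>\<^sub>1 - \<kappa>\<^sub>0) / (\<alpha> + \<beta>)"
  shows "ennreal (s powr (1 / p)) * min (ennreal (s powr - \<kappa>\<^sub>0) * N\<^sub>0) (ennreal (s powr - \<kappa>\<^sub>1) * N\<^sub>1)
    \<le> max (ennreal (c powr - \<alpha>) * (ennreal (2 powr (j * \<alpha>)) * N\<^sub>0))
          (ennreal (c powr \<beta>) * (ennreal (2 powr (j * - \<beta>)) * N\<^sub>1))
      * ennreal (lp_kernel \<alpha> \<beta> (c * s powr \<gamma> * 2 powr - j))"
proof -
  define X where "X = c * s powr \<gamma> * 2 powr - j"
  have "1 - \<theta> = \<beta> / (\<alpha> + \<beta>)"
    using \<alpha> \<beta> by (simp add: \<theta> field_simps)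
  then have "\<gamma> * \<alpha> = \<theta> * (\<kappa>\<^sub>1 - \<kappa>\<^sub>0)" "\<gamma> * \<beta> = (1 - \<theta>) * (\<kappa>\<^sub>1 - \<kappa>\<^sub>0)"
    by (simp_all add: \<gamma> \<theta>)
  then have e0: "1 / p - \<kappa>\<^sub>0 = \<gamma> * \<alpha>" and e1: "1 / p - \<kappa>\<^sub>1 = - (\<gamma> * \<beta>)"
    unfolding p by (simp_all add: algebra_simps)
  have X_powr: "X powr e = c powr e * s powr (\<gamma> * e) * 2 powr - (j * e)" for e
    using s c by (simp add: X_def powr_mult powr_powr)
  have "X powr \<alpha> * (c powr - \<alpha> * 2 powr (j * \<alpha>)) = s powr (\<gamma> * \<alpha>)"
    unfolding X_powr using s c by (simp add: powr_minus field_simps)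
  also have "\<dots> = s powr (1 / p) * s powr - \<kappa>\<^sub>0"
    by (simp flip: e0 powr_add)
  finally have X0: "s powr (1 / p) * s powr - \<kappa>\<^sub>0 = X powr \<alpha> * (c powr - \<alpha> * 2 powr (j * \<alpha>))" ..
  have "X powr - \<beta> * (c powr \<beta> * 2 powr (j * - \<beta>)) = s powr (- (\<gamma> * \<beta>))"
    unfolding X_powr using s c by (simp add: powr_minus field_simps)
  also have "\<dots> = s powr (1 / p) * s powr - \<kappa>\<^sub>1"
    by (simp flip: e1 powr_add)
  finally have X1: "s powr (1 / p) * s powr - \<kappa>\<^sub>1 = X powr - \<beta> * (c powr \<beta> * 2 powr (j * - \<beta>))" ..
  let ?L = "ennreal (s powr (1 / p)) * min (ennreal (s powr - \<kappa>\<^sub>0) * N\<^sub>0) (ennreal (s powr - \<kappa>\<^sub>1) * N\<^sub>1)"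
  let ?d0 = "ennreal (c powr - \<alpha>) * (ennreal (2 powr (j * \<alpha>)) * N\<^sub>0)"
  let ?d1 = "ennreal (c powr \<beta>) * (ennreal (2 powr (j * - \<beta>)) * N\<^sub>1)"
  have "?L \<le> ennreal (s powr (1 / p)) * (ennreal (s powr - \<kappa>\<^sub>0) * N\<^sub>0)"
    by (intro mult_left_mono) auto
  also have "\<dots> = ennreal (s powr (1 / p) * s powr - \<kappa>\<^sub>0) * N\<^sub>0"
    by (simp add: ennreal_mult' mult.assoc)
  also have "\<dots> = ?d0 * ennreal (X powr \<alpha>)"
    unfolding X0 by (simp add: ennreal_mult' ac_simps)
  finally have L0: "?L \<le> max ?d0 ?d1 * ennreal (X powr \<alpha>)"
    by (rule order.trans) (intro mult_right_mono, auto)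
  have "?L \<le> ennreal (s powr (1 / p)) * (ennreal (s powr - \<kappa>\<^sub>1) * N\<^sub>1)"
    by (intro mult_left_mono) auto
  also have "\<dots> = ennreal (s powr (1 / p) * s powr - \<kappa>\<^sub>1) * N\<^sub>1"
    by (simp add: ennreal_mult' mult.assoc)
  also have "\<dots> = ?d1 * ennreal (X powr - \<beta>)"
    unfolding X1 by (simp add: ennreal_mult' ac_simps)
  finally have L1: "?L \<le> max ?d0 ?d1 * ennreal (X powr - \<beta>)"
    by (rule order.trans) (intro mult_right_mono, auto)
  \<comment> \<open>Both bounds carry the same maximum as coefficient, so the smaller of the two
    powers may be taken.\<close>
  show ?thesis
    using L0 L1 unfolding X_def[symmetric] lp_kernel_def min_def[of "X powr \<alpha>"] by (simp split: if_splits)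
qed

text \<open>Schur's test. For r infinite the bound \<open>K\<^sub>1\<close> on the kernel sums
  suffices. Otherwise the weighted power inequality is applied for each s, and ds/s is then
  integrated term by term with the bound \<open>K\<^sub>2\<close>. C is quantified before the
  function and the sequences, so it cannot depend on them.\<close>

lemma lorentz_norm_le_lr_norm:
  fixes \<alpha> \<beta> \<theta> p \<kappa>\<^sub>0 \<kappa>\<^sub>1 :: real
  assumes \<alpha>: "0 < \<alpha>" and \<beta>: "0 < \<beta>" and \<theta>: "\<theta> = \<alpha> / (\<alpha> + \<beta>)"
    and p: "1 / p = (1 - \<theta>) * \<kappa>\<^sub>0 + \<theta> * \<kappa>\<^sub>1" and \<kappa>: "\<kappa>\<^sub>0 \<noteq> \<kappa>\<^sub>1" and r: "1 \<le> r"
  shows "\<exists>C>0. \<forall>(g :: 'a::euclidean_space \<Rightarrow> complex) N\<^sub>0 N\<^sub>1 A B. 0 < A \<longrightarrow> 0 < B \<longrightarrow>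
    (\<forall>s>0. rearrangement g s \<le>
      2 * (\<Sum>n. min (ennreal (s powr - \<kappa>\<^sub>0) * N\<^sub>0 n) (ennreal (s powr - \<kappa>\<^sub>1) * N\<^sub>1 n))) \<longrightarrow>
    lr_norm_le r (\<lambda>n. ennreal (2 powr (real_of_int (int_decode n) * \<alpha>)) * N\<^sub>0 n) A \<longrightarrow>
    lr_norm_le r (\<lambda>n. ennreal (2 powr (real_of_int (int_decode n) * - \<beta>)) * N\<^sub>1 n) B \<longrightarrow>
    lorentz_norm p r g \<le> ennreal (C * (A powr (1 - \<theta>) * B powr \<theta>))"
proof -
  define \<gamma> where "\<gamma> = (\<kappa>\<^sub>1 - \<kappa>\<^sub>0) / (\<alpha> + \<beta>)"
  have \<gamma>: "\<gamma> \<noteq> 0" using \<kappa> \<alpha> \<beta> by (simp add: \<gamma>_def)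
  define \<rho> where "\<rho> = enn2real r"
  obtain K\<^sub>1 where K1: "0 < K\<^sub>1" "\<And>x. 0 < x \<Longrightarrow>
    (\<Sum>n. ennreal (lp_kernel \<alpha> \<beta> (x * 2 powr - real_of_int (int_decode n)))) \<le> ennreal K\<^sub>1"
    using suminf_lp_kernel_bounded[OF \<alpha> \<beta>] by metis
  obtain K\<^sub>2 where K2: "0 < K\<^sub>2" "\<And>c. 0 < c \<Longrightarrow>
    (\<integral>\<^sup>+s\<in>{0<..}. (ennreal (lp_kernel \<alpha> \<beta> (c * s powr \<gamma>)) / ennreal s) \<partial>lborel) \<le> ennreal K\<^sub>2"
    using nn_integral_lp_kernel_bounded[OF \<alpha> \<beta> \<gamma>] by metis
  \<comment> \<open>For finite r the factors are, in order: the 2 in the rearrangement bound raised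
    to the power \<rho>, the constant of the weighted power inequality, the 2 from replacing a
    maximum by a sum, and the bound for the ds/s integral.\<close>
  define C where "C = (if r = \<infinity> then 2 * K\<^sub>1
    else (2 powr \<rho> * (2 powr \<rho> * K\<^sub>1 powr (\<rho> - 1)) * (2 * K\<^sub>2)) powr (1 / \<rho>))"
  have C: "0 < C" using K1 K2 by (simp add: C_def)
  have "lorentz_norm p r g \<le> ennreal (C * (A powr (1 - \<theta>) * B powr \<theta>))"
    if A: "0 < A" and B: "0 < B"
    and rearr: "\<And>s. 0 < s \<Longrightarrow> rearrangement g s \<le>
      2 * (\<Sum>n. min (ennreal (s powr - \<kappa>\<^sub>0) * N\<^sub>0 n) (ennreal (s powr - \<kappa>\<^sub>1) * N\<^sub>1 n))"
    and lA: "lr_norm_le r (\<lambda>n. ennreal (2 powr (real_of_int (int_decode n) * \<alpha>)) * N\<^sub>0 n) A"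
    and lB: "lr_norm_le r (\<lambda>n. ennreal (2 powr (real_of_int (int_decode n) * - \<beta>)) * N\<^sub>1 n) B"
    for g :: "'a \<Rightarrow> complex" and N\<^sub>0 N\<^sub>1 A B
  proof -
    define D where "D = A powr (1 - \<theta>) * B powr \<theta>"
    have D: "0 < D" using A B by (simp add: D_def)
    \<comment> \<open>Chosen to balance the two norms: c^(-\<alpha>) A and c^\<beta> B both equal D,
      the interpolated product.\<close>
    define c where "c = (A / B) powr (1 / (\<alpha> + \<beta>))"
    have c: "0 < c" using A B by (simp add: c_def)
    have \<theta>': "1 - \<theta> = \<beta> / (\<alpha> + \<beta>)" using \<alpha> \<beta> by (simp add: \<theta> field_simps)
    have c_powr: "c powr - \<alpha> = (A / B) powr - \<theta>" "c powr \<beta> = (A / B) powr (1 - \<theta>)"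
      unfolding \<theta>' by (simp_all add: c_def powr_powr \<theta>)
    have cA: "c powr - \<alpha> * A = D" and cB: "c powr \<beta> * B = D"
      unfolding c_powr using A B by (simp_all add: D_def powr_divide powr_minus powr_diff field_simps)
    define a where "a n = ennreal (2 powr (real_of_int (int_decode n) * \<alpha>)) * N\<^sub>0 n" for n
    define b where "b n = ennreal (2 powr (real_of_int (int_decode n) * - \<beta>)) * N\<^sub>1 n" for n
    define d where "d n = max (ennreal (c powr - \<alpha>) * a n) (ennreal (c powr \<beta>) * b n)" for n
    define w where "w s n = ennreal (lp_kernel \<alpha> \<beta> (c * s powr \<gamma> * 2 powr - real_of_int (int_decode n)))" for s n
    have w_sum: "(\<Sum>n. w s n) \<le> ennreal K\<^sub>1" if "0 < s" for s
      unfolding w_def using c that by (intro K1) auto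
    have main: "ennreal (s powr (1 / p)) * rearrangement g s \<le> 2 * (\<Sum>n. d n * w s n)" if s: "0 < s" for s
    proof -
      have "ennreal (s powr (1 / p)) * rearrangement g s \<le> ennreal (s powr (1 / p)) *
          (2 * (\<Sum>n. min (ennreal (s powr - \<kappa>\<^sub>0) * N\<^sub>0 n) (ennreal (s powr - \<kappa>\<^sub>1) * N\<^sub>1 n)))"
        by (intro mult_left_mono rearr s) auto
      also have "\<dots> = 2 * (\<Sum>n. ennreal (s powr (1 / p)) *
          min (ennreal (s powr - \<kappa>\<^sub>0) * N\<^sub>0 n) (ennreal (s powr - \<kappa>\<^sub>1) * N\<^sub>1 n))"
        by (simp add: mult.left_commute)
      also have "\<dots> \<le> 2 * (\<Sum>n. d n * w s n)"
        unfolding d_def a_def b_def w_def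
        by (intro mult_left_mono suminf_le min_le_max_mult_lp_kernel[OF \<alpha> \<beta> s c \<theta> p \<gamma>_def]) auto
      finally show ?thesis .
    qed
    show ?thesis
    proof (cases "r = \<infinity>")
      case True
      have d: "d n \<le> ennreal D" for n
      proof -
        have "ennreal (c powr - \<alpha>) * a n \<le> ennreal (c powr - \<alpha>) * ennreal A"
          using lA True by (intro mult_left_mono) (auto simp: lr_norm_le_def a_def)
        moreover have "ennreal (c powr \<beta>) * b n \<le> ennreal (c powr \<beta>) * ennreal B"
          using lB True by (intro mult_left_mono) (auto simp: lr_norm_le_def b_def)
        ultimately show ?thesis
          using A B by (simp add: d_def cA cB flip: ennreal_mult')
      qed
      have "ennreal (s powr (1 / p)) * rearrangement g s \<le> ennreal (C * D)" if s: "0 < s" for s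
      proof -
        have "(\<Sum>n. d n * w s n) \<le> (\<Sum>n. ennreal D * w s n)"
          by (intro suminf_le mult_right_mono d) auto
        also have "\<dots> \<le> ennreal D * ennreal K\<^sub>1"
          using w_sum[OF s] by (simp add: mult_left_mono)
        finally have "2 * (\<Sum>n. d n * w s n) \<le> 2 * (ennreal D * ennreal K\<^sub>1)"
          by (intro mult_left_mono) auto
        also have "\<dots> = ennreal (C * D)"
          using True K1 D by (simp add: C_def ennreal_mult' ac_simps)
        finally show ?thesis using main[OF s] by (rule order.trans[rotated])
      qed
      then show ?thesis
        using True by (auto simp: lorentz_norm_def D_def intro!: SUP_least)
    next
      case False
      have \<rho>: "1 \<le> \<rho>" using inverse_exponent False r unfolding \<rho>_def by blast
      \<comment> \<open>The \<rho>-th power of a maximum is at most the sum of the two \<rho>-th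
        powers, and by the choice of c each of the two sums is at most D^\<rho>.\<close>
      have d: "(\<Sum>n. epowr (d n) \<rho>) \<le> ennreal (2 * D powr \<rho>)"
      proof -
        have "(\<Sum>n. epowr (d n) \<rho>) \<le> (\<Sum>n. ennreal ((c powr - \<alpha>) powr \<rho>) * epowr (a n) \<rho> +
            ennreal ((c powr \<beta>) powr \<rho>) * epowr (b n) \<rho>)"
        proof (intro suminf_le)
          fix n
          show "epowr (d n) \<rho> \<le> ennreal ((c powr - \<alpha>) powr \<rho>) * epowr (a n) \<rho> +
              ennreal ((c powr \<beta>) powr \<rho>) * epowr (b n) \<rho>"
            using \<rho> by (auto simp: d_def max_def epowr_mult epowr_ennreal intro: add_increasing add_increasing2)
        qed auto
        also have "\<dots> = ennreal ((c powr - \<alpha>) powr \<rho>) * (\<Sum>n. epowr (a n) \<rho>) +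
            ennreal ((c powr \<beta>) powr \<rho>) * (\<Sum>n. epowr (b n) \<rho>)"
          by (subst suminf_add[symmetric]) auto
        also have "\<dots> \<le> ennreal ((c powr - \<alpha>) powr \<rho>) * ennreal (A powr \<rho>) +
            ennreal ((c powr \<beta>) powr \<rho>) * ennreal (B powr \<rho>)"
          using lA lB False by (intro add_mono mult_left_mono) (auto simp: lr_norm_le_def a_def b_def \<rho>_def)
        also have "\<dots> = ennreal (D powr \<rho>) + ennreal (D powr \<rho>)"
          using A B c by (simp add: cA cB flip: ennreal_mult' powr_mult)
        also have "\<dots> = ennreal (2 * D powr \<rho>)"
          by (simp flip: ennreal_plus)
        finally show ?thesis .
      qed
      let ?k = "ennreal (2 powr \<rho> * (2 powr \<rho> * K\<^sub>1 powr (\<rho> - 1)))"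
      have [measurable]: "(\<lambda>s. w s n) \<in> borel_measurable borel" for n
        unfolding w_def lp_kernel_def by measurable
      have "(\<integral>\<^sup>+s\<in>{0<..}. (epowr (ennreal (s powr (1 / p)) * rearrangement g s) \<rho> / ennreal s) \<partial>lborel)
        \<le> (\<integral>\<^sup>+s. (\<Sum>n. ?k * (epowr (d n) \<rho> * (w s n / ennreal s * indicator {0<..} s))) \<partial>lborel)"
      proof (rule nn_integral_mono)
        fix s :: real
        show "epowr (ennreal (s powr (1 / p)) * rearrangement g s) \<rho> / ennreal s * indicator {0<..} s
          \<le> (\<Sum>n. ?k * (epowr (d n) \<rho> * (w s n / ennreal s * indicator {0<..} s)))"
        proof (cases "0 < s")
          case s: True
          have "epowr (ennreal (s powr (1 / p)) * rearrangement g s) \<rho> \<le> epowr (2 * (\<Sum>n. d n * w s n)) \<rho>"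
            using \<rho> by (intro epowr_mono main s) auto
          also have "\<dots> = ennreal (2 powr \<rho>) * epowr (\<Sum>n. d n * w s n) \<rho>"
            using \<rho> epowr_ennreal[of 2 \<rho>] by (simp add: epowr_mult)
          also have "\<dots> \<le> ennreal (2 powr \<rho>) *
              (ennreal (2 powr \<rho> * K\<^sub>1 powr (\<rho> - 1)) * (\<Sum>n. epowr (d n) \<rho> * w s n))"
            by (intro mult_left_mono epowr_suminf_weighted_le[OF \<rho> K1(1) w_sum[OF s]]) auto
          also have "\<dots> = ?k * (\<Sum>n. epowr (d n) \<rho> * w s n)"
            by (simp add: ennreal_mult' mult.assoc)
          finally have "epowr (ennreal (s powr (1 / p)) * rearrangement g s) \<rho> / ennreal s
             \<le> ?k * (\<Sum>n. epowr (d n) \<rho> * w s n) / ennreal s"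
            by (rule divide_right_mono_ennreal)
          also have "\<dots> = (\<Sum>n. ?k * (epowr (d n) \<rho> * (w s n / ennreal s)))"
            by (simp add: divide_ennreal_def mult.assoc ennreal_suminf_multc[symmetric])
          finally show ?thesis using s by simp
        qed simp
      qed
      also have "\<dots> = (\<Sum>n. ?k * (epowr (d n) \<rho> * (\<integral>\<^sup>+s\<in>{0<..}. (w s n / ennreal s) \<partial>lborel)))"
        by (subst nn_integral_suminf) (auto simp: nn_integral_cmult)
      also have "\<dots> \<le> (\<Sum>n. ?k * (epowr (d n) \<rho> * ennreal K\<^sub>2))"
      proof (intro suminf_le mult_left_mono)
        fix n
        \<comment> \<open>For fixed n the dyadic factor merges with c into one positive constant, on
          which \<open>K\<^sub>2\<close> does not depend.\<close>
        show "(\<integral>\<^sup>+s\<in>{0<..}. (w s n / ennreal s) \<partial>lborel) \<le> ennreal K\<^sub>2"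
          using K2(2)[of "c * 2 powr - real_of_int (int_decode n)"] c by (simp add: w_def ac_simps)
      qed auto
      also have "\<dots> = ?k * ((\<Sum>n. epowr (d n) \<rho>) * ennreal K\<^sub>2)"
        by (simp add: ennreal_suminf_multc)
      also have "\<dots> \<le> ?k * (ennreal (2 * D powr \<rho>) * ennreal K\<^sub>2)"
        by (intro mult_left_mono mult_right_mono d) auto
      also have "\<dots> = ennreal (C powr \<rho> * D powr \<rho>)"
        using K1 K2 \<rho> False by (simp add: C_def powr_powr ac_simps flip: ennreal_mult')
      finally have "epowr (\<integral>\<^sup>+s\<in>{0<..}. (epowr (ennreal (s powr (1 / p)) * rearrangement g s) \<rho> / ennreal s) \<partial>lborel) (1 / \<rho>)
         \<le> epowr (ennreal (C powr \<rho> * D powr \<rho>)) (1 / \<rho>)"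
        using \<rho> by (intro epowr_mono) auto
      also have "\<dots> = ennreal (C * D)"
        using \<rho> C D by (simp add: epowr_ennreal powr_powr flip: powr_mult)
      finally show ?thesis
        using False by (simp add: lorentz_norm_def D_def \<rho>_def)
    qed
  qed
  then show ?thesis using C by blast
qed

section \<open>Exponents as real numbers, and assembly of the proof\<close>

text \<open>All reciprocals 1/q are finite, with 1/q = 0 exactly for q infinite, so the extended
  identity can be read among real numbers. An exponent is recovered from its reciprocal, hence
  distinct exponents have distinct reciprocals.\<close>

lemma exponent_relation:
  assumes "1 \<le> q\<^sub>0" "1 \<le> q\<^sub>1" "q\<^sub>0 \<noteq> q\<^sub>1" "0 \<le> \<theta>" "\<theta> \<le> 1"
    and "1 / ennreal p = ennreal (1 - \<theta>) / q\<^sub>0 + ennreal \<theta> / q\<^sub>1"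
  shows "1 / p = (1 - \<theta>) * enn2real (1 / q\<^sub>0) + \<theta> * enn2real (1 / q\<^sub>1)"
    and "enn2real (1 / q\<^sub>0) \<noteq> enn2real (1 / q\<^sub>1)"
proof -
  have inv: "1 / q = ennreal (enn2real (1 / q))" if "1 \<le> q" for q :: ennreal
  proof -
    have "1 / q \<noteq> top"
      using that by (auto simp: divide_ennreal_def)
    then show ?thesis by (simp add: less_top)
  qed
  show "enn2real (1 / q\<^sub>0) \<noteq> enn2real (1 / q\<^sub>1)"
  proof -
    have "q = (if enn2real (1 / q) = 0 then \<infinity> else ennreal (1 / enn2real (1 / q)))" if "1 \<le> q" for q
      using inverse_exponent[OF that] by (cases "q = \<infinity>") auto
    from this[OF assms(1)] this[OF assms(2)] assms(3) show ?thesis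
      by metis
  qed
  have "ennreal (1 - \<theta>) / q\<^sub>0 + ennreal \<theta> / q\<^sub>1 = ennreal (1 - \<theta>) * (1 / q\<^sub>0) + ennreal \<theta> * (1 / q\<^sub>1)"
    by (simp add: divide_ennreal_def)
  also have "\<dots> = ennreal ((1 - \<theta>) * enn2real (1 / q\<^sub>0) + \<theta> * enn2real (1 / q\<^sub>1))"
    using assms by (subst (1 2) inv) (auto simp: ennreal_mult' ennreal_plus)
  finally have *: "1 / ennreal p = ennreal ((1 - \<theta>) * enn2real (1 / q\<^sub>0) + \<theta> * enn2real (1 / q\<^sub>1))"
    using assms by simp
  \<comment> \<open>For p \<le> 0 the number \<open>ennreal p\<close> is 0 and its reciprocal
    infinite, against a finite right-hand side.\<close>
  have "0 < p"
    using * by (cases "0 < p") (auto simp: ennreal_neg divide_ennreal_def)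
  then have "ennreal (1 / p) = ennreal ((1 - \<theta>) * enn2real (1 / q\<^sub>0) + \<theta> * enn2real (1 / q\<^sub>1))"
    using * by (simp add: divide_ennreal flip: ennreal_1)
  then show "1 / p = (1 - \<theta>) * enn2real (1 / q\<^sub>0) + \<theta> * enn2real (1 / q\<^sub>1)"
    using assms \<open>0 < p\<close> by (subst (asm) ennreal_inj) auto
qed

theorem theorem2:
  fixes \<phi> :: "real ^ 'n \<Rightarrow> real"
    and \<alpha> \<beta> \<theta> p :: real
    and q\<^sub>0 q\<^sub>1 r :: ennreal
  assumes "LP_cutoff \<phi>"
    and "\<alpha> > 0" and "\<beta> > 0"
    and "1 \<le> q\<^sub>0" and "1 \<le> q\<^sub>1" and "q\<^sub>0 \<noteq> q\<^sub>1"
    and "\<theta> = \<alpha> / (\<alpha> + \<beta>)"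
    and "1 / ennreal p = ennreal (1 - \<theta>) / q\<^sub>0 + ennreal \<theta> / q\<^sub>1"
    and "1 \<le> r"
  shows "\<exists>C\<^sub>0::real. \<forall>f :: (real ^ 'n) functional.
    in_besov_inter \<phi> \<alpha> q\<^sub>0 r (- \<beta>) q\<^sub>1 r f \<longrightarrow>
    (\<exists>g. represents g f \<and> lorentz_norm p r g < \<infinity> \<and>
      lorentz_norm p r g \<le>
        ennreal C\<^sub>0 * epowr (besov_seminorm \<phi> \<alpha> q\<^sub>0 r f) (1 - \<theta>)
                    * epowr (besov_seminorm \<phi> (- \<beta>) q\<^sub>1 r f) \<theta>)"
proof -
  note \<phi> = assms(1) and \<alpha> = assms(2) and \<beta> = assms(3) and q0 = assms(4) and q1 = assms(5) and r = assms(9)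
  have \<theta>: "0 < \<theta>" "\<theta> < 1"
    unfolding assms(7) using \<alpha> \<beta> by simp_all
  define \<kappa>\<^sub>0 where "\<kappa>\<^sub>0 = enn2real (1 / q\<^sub>0)"
  define \<kappa>\<^sub>1 where "\<kappa>\<^sub>1 = enn2real (1 / q\<^sub>1)"
  have p: "1 / p = (1 - \<theta>) * \<kappa>\<^sub>0 + \<theta> * \<kappa>\<^sub>1" and \<kappa>: "\<kappa>\<^sub>0 \<noteq> \<kappa>\<^sub>1"
    using exponent_relation[OF q0 q1 assms(6) _ _ assms(8)] \<theta> by (auto simp: \<kappa>\<^sub>0_def \<kappa>\<^sub>1_def)
  obtain C where C: "0 < C" "\<forall>(g :: real ^ 'n \<Rightarrow> complex) N\<^sub>0 N\<^sub>1 A B. 0 < A \<longrightarrow> 0 < B \<longrightarrow>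
    (\<forall>s>0. rearrangement g s \<le>
      2 * (\<Sum>n. min (ennreal (s powr - \<kappa>\<^sub>0) * N\<^sub>0 n) (ennreal (s powr - \<kappa>\<^sub>1) * N\<^sub>1 n))) \<longrightarrow>
    lr_norm_le r (\<lambda>n. ennreal (2 powr (real_of_int (int_decode n) * \<alpha>)) * N\<^sub>0 n) A \<longrightarrow>
    lr_norm_le r (\<lambda>n. ennreal (2 powr (real_of_int (int_decode n) * - \<beta>)) * N\<^sub>1 n) B \<longrightarrow>
    lorentz_norm p r g \<le> ennreal (C * (A powr (1 - \<theta>) * B powr \<theta>))"
    using lorentz_norm_le_lr_norm[OF \<alpha> \<beta> assms(7) p \<kappa> r] by blast
  show ?thesis
  proof (rule exI[of _ C], intro allI impI)
    fix f :: "(real ^ 'n) functional"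
    assume f: "in_besov_inter \<phi> \<alpha> q\<^sub>0 r (- \<beta>) q\<^sub>1 r f"
    obtain a where a: "besov_seminorm \<phi> \<alpha> q\<^sub>0 r f = ennreal a" "0 \<le> a"
      using f by (cases "besov_seminorm \<phi> \<alpha> q\<^sub>0 r f") (auto simp: in_besov_inter_def)
    obtain b where b: "besov_seminorm \<phi> (- \<beta>) q\<^sub>1 r f = ennreal b" "0 \<le> b"
      using f by (cases "besov_seminorm \<phi> (- \<beta>) q\<^sub>1 r f") (auto simp: in_besov_inter_def)
    let ?\<Delta> = "\<lambda>j. dyadic_block \<phi> j f"
    have la: "lr_norm_le r (\<lambda>n. ennreal (2 powr (real_of_int (int_decode n) * \<alpha>)) *
        Lq_norm_dist q\<^sub>0 (?\<Delta> (int_decode n))) (a + e)" if "0 < e" for e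
      using a that by (intro besov_seminorm_le_imp_lr_norm_le r) (auto intro: ennreal_leI)
    have lb: "lr_norm_le r (\<lambda>n. ennreal (2 powr (real_of_int (int_decode n) * - \<beta>)) *
        Lq_norm_dist q\<^sub>1 (?\<Delta> (int_decode n))) (b + e)" if "0 < e" for e
      using b that by (intro besov_seminorm_le_imp_lr_norm_le r) (auto intro: ennreal_leI)
    have a_le: "ennreal (2 powr (real_of_int (int_decode n) * \<alpha>)) * Lq_norm_dist q\<^sub>0 (?\<Delta> (int_decode n)) \<le> ennreal (a + 1)" for n
      using lr_norm_le_imp_le[OF r _ la[of 1]] a by simp
    have b_le: "ennreal (2 powr (real_of_int (int_decode n) * - \<beta>)) * Lq_norm_dist q\<^sub>1 (?\<Delta> (int_decode n)) \<le> ennreal (b + 1)" for n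
      using lr_norm_le_imp_le[OF r _ lb[of 1]] b by simp
    \<comment> \<open>A block that is no function would have norm infinity, being an infimum over
      the empty set, while the weighted norms are bounded by a + 1.\<close>
    have "\<exists>g. represents g (?\<Delta> j)" for j
    proof (rule ccontr)
      assume "\<nexists>g. represents g (?\<Delta> j)"
      then have "Lq_norm_dist q\<^sub>0 (?\<Delta> j) = top"
        by (simp add: Lq_norm_dist_def)
      with a_le[of "int_encode j"] show False
        by (simp add: ennreal_mult_top top_unique del: ennreal_plus)
    qed
    then obtain F where F: "\<And>j. represents (F j) (?\<Delta> j)"
      by metis
    have [measurable]: "F j \<in> borel_measurable lborel" for j
      using F[of j] by (simp add: represents_def)
    have N: "Lq_norm_dist q (?\<Delta> j) = Lq_norm q (F j)" for q j
      by (rule Lq_norm_dist_eq[OF \<phi> F])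
    define m where "m n = min (Lq_norm q\<^sub>0 (F (int_decode n))) (Lq_norm q\<^sub>1 (F (int_decode n)))" for n
    \<comment> \<open>The kernel inequality at s = c = 1 bounds the smaller of the two norms of each
      block by a constant times a summable kernel value. Only the uniform bounds \<open>a_le\<close>
      and \<open>b_le\<close> enter, whatever r is.\<close>
    have m: "(\<Sum>n. m n) < \<infinity>"
    proof -
      obtain K where K: "0 < K" "\<And>x. 0 < x \<Longrightarrow>
          (\<Sum>n. ennreal (lp_kernel \<alpha> \<beta> (x * 2 powr - real_of_int (int_decode n)))) \<le> ennreal K"
        using suminf_lp_kernel_bounded[OF \<alpha> \<beta>] by metis
      have "m n \<le> ennreal (max (a + 1) (b + 1)) * ennreal (lp_kernel \<alpha> \<beta> (1 * 2 powr - real_of_int (int_decode n)))" for n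
      proof -
        have "m n \<le> max (ennreal (2 powr (real_of_int (int_decode n) * \<alpha>)) * Lq_norm q\<^sub>0 (F (int_decode n)))
            (ennreal (2 powr (real_of_int (int_decode n) * - \<beta>)) * Lq_norm q\<^sub>1 (F (int_decode n)))
            * ennreal (lp_kernel \<alpha> \<beta> (1 * 2 powr - real_of_int (int_decode n)))"
          using min_le_max_mult_lp_kernel[OF \<alpha> \<beta> _ _ assms(7) p refl, of 1 1] by (simp add: m_def)
        also have "\<dots> \<le> ennreal (max (a + 1) (b + 1)) * ennreal (lp_kernel \<alpha> \<beta> (1 * 2 powr - real_of_int (int_decode n)))"
        proof (intro mult_right_mono max.boundedI)
          show "ennreal (2 powr (real_of_int (int_decode n) * \<alpha>)) * Lq_norm q\<^sub>0 (F (int_decode n)) \<le> ennreal (max (a + 1) (b + 1))"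
            using a_le[of n, unfolded N] by (rule order.trans) (auto intro: ennreal_leI simp del: ennreal_plus)
          show "ennreal (2 powr (real_of_int (int_decode n) * - \<beta>)) * Lq_norm q\<^sub>1 (F (int_decode n)) \<le> ennreal (max (a + 1) (b + 1))"
            using b_le[of n, unfolded N] by (rule order.trans) (auto intro: ennreal_leI simp del: ennreal_plus)
        qed auto
        finally show ?thesis .
      qed
      then have "(\<Sum>n. m n) \<le> (\<Sum>n. ennreal (max (a + 1) (b + 1)) * ennreal (lp_kernel \<alpha> \<beta> (1 * 2 powr - real_of_int (int_decode n))))"
        by (intro suminf_le) auto
      also have "\<dots> \<le> ennreal (max (a + 1) (b + 1)) * ennreal K"
        unfolding ennreal_suminf_cmult by (intro mult_left_mono K) auto
      also have "\<dots> < \<infinity>"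
        by (simp add: ennreal_mult_less_top)
      finally show ?thesis .
    qed
    obtain g where g: "represents g f"
      "AE x in lborel. ennreal (norm (g x)) \<le> (\<Sum>n. ennreal (norm (F (int_decode n) x)))"
    proof (rule LP_series_represents[OF \<phi> _ F])
      show "LP_sum_converges \<phi> f"
        using f by (simp add: in_besov_inter_def)
      fix u :: "real ^ 'n \<Rightarrow> complex" assume "u \<in> schwartz"
      then obtain Cu where Cu: "0 < Cu" "\<And>q g. 1 \<le> q \<Longrightarrow> g \<in> borel_measurable lborel \<Longrightarrow>
          (\<integral>\<^sup>+y. ennreal (norm (g y)) * ennreal (norm (u y)) \<partial>lborel) \<le> ennreal Cu * Lq_norm q g"
        using nn_integral_schwartz_le_Lq_norm by metis
      \<comment> \<open>The constant \<open>Cu\<close> is common to both exponents, so each pairing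
        is controlled by the smaller norm \<open>m n\<close>, and these are summable.\<close>
      have "(\<Sum>n. \<integral>\<^sup>+x. ennreal (norm (F (int_decode n) x)) * ennreal (norm (u x)) \<partial>lborel)
          \<le> (\<Sum>n. ennreal Cu * m n)"
      proof (intro suminf_le)
        fix n
        show "(\<integral>\<^sup>+x. ennreal (norm (F (int_decode n) x)) * ennreal (norm (u x)) \<partial>lborel) \<le> ennreal Cu * m n"
          using Cu(2)[OF q0, of "F (int_decode n)"] Cu(2)[OF q1, of "F (int_decode n)"] by (simp add: m_def min_def)
      qed auto
      also have "\<dots> < \<infinity>"
        using m by (simp add: ennreal_mult_less_top)
      finally show "(\<Sum>n. \<integral>\<^sup>+x. ennreal (norm (F (int_decode n) x)) * ennreal (norm (u x)) \<partial>lborel) < \<infinity>" .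
    qed
    have [measurable]: "g \<in> borel_measurable lborel"
      using g(1) by (simp add: represents_def)
    txt \<open>Enlarging both semi-norms by \<open>e\<close> covers the case where one of them vanishes.\<close>
    have bound: "lorentz_norm p r g \<le> ennreal (C * ((a + e) powr (1 - \<theta>) * (b + e) powr \<theta>))" if "0 < e" for e
      using that a b la[OF that] lb[OF that] unfolding N
      by (intro C(2)[rule_format, where N\<^sub>0 = "\<lambda>n. Lq_norm q\<^sub>0 (F (int_decode n))" and N\<^sub>1 = "\<lambda>n. Lq_norm q\<^sub>1 (F (int_decode n))"]
          rearrangement_series_le[OF q0 q1 _ _ g(2), folded \<kappa>\<^sub>0_def \<kappa>\<^sub>1_def]) auto
    \<comment> \<open>Both exponents 1 - \<theta> and \<theta> are positive, so the powers are
      continuous down to e = 0 even when a or b is 0.\<close>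
    have "(\<lambda>n. ennreal (C * ((a + inverse (real (Suc n))) powr (1 - \<theta>) * (b + inverse (real (Suc n))) powr \<theta>)))
        \<longlonglongrightarrow> ennreal (C * ((a + 0) powr (1 - \<theta>) * (b + 0) powr \<theta>))"
      using \<theta> a b
      by (intro tendsto_ennrealI tendsto_mult tendsto_const tendsto_powr' tendsto_add LIMSEQ_inverse_real_of_nat) auto
    then have "lorentz_norm p r g \<le> ennreal (C * ((a + 0) powr (1 - \<theta>) * (b + 0) powr \<theta>))"
      by (rule LIMSEQ_le_const) (use bound in auto)
    then have le: "lorentz_norm p r g \<le> ennreal C * epowr (besov_seminorm \<phi> \<alpha> q\<^sub>0 r f) (1 - \<theta>)
                    * epowr (besov_seminorm \<phi> (- \<beta>) q\<^sub>1 r f) \<theta>"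
      using a b C(1) by (simp add: epowr_ennreal ennreal_mult' mult.assoc)
    also have "\<dots> < \<infinity>"
      using a b by (simp add: epowr_ennreal ennreal_mult_less_top)
    finally show "\<exists>g. represents g f \<and> lorentz_norm p r g < \<infinity> \<and>
      lorentz_norm p r g \<le> ennreal C * epowr (besov_seminorm \<phi> \<alpha> q\<^sub>0 r f) (1 - \<theta>)
                    * epowr (besov_seminorm \<phi> (- \<beta>) q\<^sub>1 r f) \<theta>"
      using g(1) le by blast
  qed
qed

end
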